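(* Let $k$ be a perfect field of characteristic $p>0$, let $S$ be a graded polynomial ring over $k$ (in finitely many variables), and let $R\subset S$ be a graded $k$-subalgebra. Assume that the inclusion $R\hookrightarrow S$ splits in the category of graded $R$-modules. Then the ring $D_k(R)$ of $k$-linear differential operators on $R$ is a simple ring.
   Context: For a commutative ring $k$ and a commutative $k$-algebra $R$, $D_k(R)=\bigcup_{n\ge 0}D_k^n(R)\subset \operatorname{End}_k(R)$, where $D_k^0(R)=\operatorname{Hom}_R(R,R)$ and $D_k^n(R)=\{\theta\in\operatorname{Hom}_k(R,R)\mid r\circ\theta-\theta\circ r\in D_k^{n-1}(R)\text{ for all } r\in R\}$ (an element $r\in R$ is identified with multiplication by $r$). It is a ring under composition. A ring is simple if it is non-zero and has no two-sided ideals other than $0$ and itself. *)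

theory Defs
  imports "HOL-Algebra.Algebraic_Closure_Type" "HOL-Library.Poly_Mapping"
begin

definition perfect_field :: "'k::field itself \<Rightarrow> bool" where
  "perfect_field _ \<longleftrightarrow>
     (\<forall>f :: 'k poly. Factorial_Ring.irreducible f \<longrightarrow> Rings.coprime f (Polynomial.pderiv f))"

definition simple_ring :: "('a, 'm) ring_scheme \<Rightarrow> bool" where
  "simple_ring D \<longleftrightarrow> ring D \<and> carrier D \<noteq> {\<zero>\<^bsub>D\<^esub>} \<and>
     (\<forall>I. ideal I D \<longrightarrow> I = {\<zero>\<^bsub>D\<^esub>} \<or> I = carrier D)"

text \<open>Maps are extensional, so that homomorphisms agreeing on the carrier are equal.\<close>

definition module_Hom ::
    "('a, 'l) ring_scheme \<Rightarrow> ('a, 'b, 'm) module_scheme \<Rightarrow> ('a, 'c, 'n) module_scheme \<Rightarrow> ('b \<Rightarrow> 'c) set"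
  where
  "module_Hom K M N = {f \<in> carrier M \<rightarrow>\<^sub>E carrier N.
     (\<forall>x\<in>carrier M. \<forall>y\<in>carrier M. f (x \<oplus>\<^bsub>M\<^esub> y) = f x \<oplus>\<^bsub>N\<^esub> f y) \<and>
     (\<forall>c\<in>carrier K. \<forall>x\<in>carrier M. f (c \<odot>\<^bsub>M\<^esub> x) = c \<odot>\<^bsub>N\<^esub> f x)}"

text \<open>A ring with its own multiplication as scalar action. The same record also serves as the
  ring regarded as a module over any of its subrings.\<close>

definition regular_module :: "('a, 'm) ring_scheme \<Rightarrow> ('a, 'a) module" where
  "regular_module A = \<lparr>carrier = carrier A, monoid.mult = monoid.mult A, one = one A,
     ring.zero = ring.zero A, add = add A, module.smult = monoid.mult A\<rparr>"

primrec diff_ops ::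
    "('a, 'l) ring_scheme \<Rightarrow> ('a, 'b, 'm) module_scheme \<Rightarrow> nat \<Rightarrow> ('b \<Rightarrow> 'b) set" where
  "diff_ops K A 0 = module_Hom A (regular_module A) (regular_module A)"
| "diff_ops K A (Suc n) = {\<theta> \<in> module_Hom K A A. \<forall>r\<in>carrier A.
     (\<lambda>x\<in>carrier A. r \<otimes>\<^bsub>A\<^esub> \<theta> x \<ominus>\<^bsub>A\<^esub> \<theta> (r \<otimes>\<^bsub>A\<^esub> x)) \<in> diff_ops K A n}"

definition diff_op_ring ::
    "('a, 'l) ring_scheme \<Rightarrow> ('a, 'b, 'm) module_scheme \<Rightarrow> ('b \<Rightarrow> 'b) ring" where
  "diff_op_ring K A = \<lparr>
     carrier = (\<Union>n. diff_ops K A n),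
     monoid.mult = compose (carrier A),
     one = (\<lambda>x\<in>carrier A. x),
     ring.zero = (\<lambda>x\<in>carrier A. \<zero>\<^bsub>A\<^esub>),
     add = (\<lambda>\<theta> \<eta>. \<lambda>x\<in>carrier A. \<theta> x \<oplus>\<^bsub>A\<^esub> \<eta> x)\<rparr>"

text \<open>The polynomial ring in the variables \<open>x\<^sub>0, \<dots>, x\<^sub>n\<^sub>-\<^sub>1\<close>. A polynomial maps exponent vectors
  \<open>nat \<Rightarrow>\<^sub>0 nat\<close> to coefficients, and multiplication of finitely supported maps is convolution.\<close>

type_synonym 'k mpoly = "(nat \<Rightarrow>\<^sub>0 nat) \<Rightarrow>\<^sub>0 'k"

definition poly_algebra :: "nat \<Rightarrow> ('k::field, 'k mpoly) module" where
  "poly_algebra n = \<lparr>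
     carrier = {f. \<forall>m \<in> Poly_Mapping.keys f. Poly_Mapping.keys m \<subseteq> {..<n}},
     monoid.mult = (*), one = 1, ring.zero = 0, add = (+),
     module.smult = (\<lambda>c f. Poly_Mapping.single 0 c * f)\<rparr>"

lemma poly_algebra_algebra: "algebra (ring_of_type_algebra :: 'k::field ring) (poly_algebra n)"
proof -
  define C :: "'k mpoly set" where "C = carrier (poly_algebra n)"
  have C: "f \<in> C \<longleftrightarrow> (\<forall>m \<in> Poly_Mapping.keys f. Poly_Mapping.keys m \<subseteq> {..<n})" for f
    by (simp add: C_def poly_algebra_def)
  have mult: "f * g \<in> C" if "f \<in> C" "g \<in> C" for f g
    unfolding C
  proof
    fix m assume "m \<in> Poly_Mapping.keys (f * g)"
    then obtain a b where "m = a + b" "a \<in> Poly_Mapping.keys f" "b \<in> Poly_Mapping.keys g"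
      using keys_mult[of f g] by blast
    then show "Poly_Mapping.keys m \<subseteq> {..<n}"
      using that Poly_Mapping.keys_add[of a b] unfolding C by blast
  qed
  have plus: "f + g \<in> C" if "f \<in> C" "g \<in> C" for f g
    using that Poly_Mapping.keys_add[of f g] unfolding C by blast
  have const: "Poly_Mapping.single 0 c \<in> C" "1 \<in> C" "0 \<in> C" for c
    by (simp_all add: C)
  have uminus: "- f \<in> C" if "f \<in> C" for f
    using that by (simp add: C)
  have ops: "carrier (poly_algebra n) = C" "add (poly_algebra n) = ((+) :: 'k mpoly \<Rightarrow> _)"
    "monoid.mult (poly_algebra n) = ((*) :: 'k mpoly \<Rightarrow> _)" "\<one>\<^bsub>poly_algebra n\<^esub> = (1 :: 'k mpoly)"
    "\<zero>\<^bsub>poly_algebra n\<^esub> = (0 :: 'k mpoly)"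
    "module.smult (poly_algebra n) = (\<lambda>(c::'k) f. Poly_Mapping.single 0 c * f)"
    by (simp_all add: C_def) (simp_all add: poly_algebra_def)
  have grp: "abelian_group (poly_algebra n :: ('k, 'k mpoly) module)"
  proof (rule abelian_groupI, unfold ops)
    show "\<exists>g\<in>C. g + f = 0" if "f \<in> C" for f
      using uminus[OF that] by (intro bexI[of _ "- f"]) simp_all
  qed (simp_all add: plus const add_ac)
  have mon: "Group.comm_monoid (poly_algebra n :: ('k, 'k mpoly) module)"
    by (rule Group.comm_monoidI, unfold ops) (simp_all add: mult const mult_ac)
  have cring: "cring (poly_algebra n :: ('k, 'k mpoly) module)"
    by (rule cringI[OF grp mon], unfold ops) (simp add: distrib_right)
  show ?thesis
    by (rule algebraI[OF cring_from_type_algebra cring], unfold ops ring_of_type_algebra_def)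
      (simp_all add: mult const single_add distrib_left distrib_right mult_single flip: mult.assoc)
qed

text \<open>The degree of a monomial in the grading with \<open>deg x\<^sub>i = w i\<close>.\<close>

definition wdeg :: "(nat \<Rightarrow> nat) \<Rightarrow> (nat \<Rightarrow>\<^sub>0 nat) \<Rightarrow> nat" where
  "wdeg w m = (\<Sum>i\<in>Poly_Mapping.keys m. w i * Poly_Mapping.lookup m i)"

definition poly_piece :: "nat \<Rightarrow> (nat \<Rightarrow> nat) \<Rightarrow> nat \<Rightarrow> 'k::field mpoly set" where
  "poly_piece n w d =
     {f \<in> carrier (poly_algebra n). \<forall>m \<in> Poly_Mapping.keys f. wdeg w m = d}"

definition hom_component :: "(nat \<Rightarrow> nat) \<Rightarrow> nat \<Rightarrow> 'k::field mpoly \<Rightarrow> 'k mpoly" where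
  "hom_component w d f =
     Poly_Mapping.mapp (\<lambda>m c. if wdeg w m = d then c else 0) f"

definition graded_subalgebra :: "nat \<Rightarrow> (nat \<Rightarrow> nat) \<Rightarrow> 'k::field mpoly set \<Rightarrow> bool" where
  "graded_subalgebra n w R \<longleftrightarrow>
     subring R (poly_algebra n) \<and>
     submodule R (ring_of_type_algebra :: 'k ring) (poly_algebra n) \<and>
     (\<forall>f\<in>R. \<forall>d. hom_component w d f \<in> R)"

abbreviation subalg :: "nat \<Rightarrow> 'k::field mpoly set \<Rightarrow> ('k, 'k mpoly) module" where
  "subalg n R \<equiv> (poly_algebra n)\<lparr>carrier := R\<rparr>"

lemma subalg_algebra:
  fixes R :: "'k::field mpoly set"
  assumes "graded_subalgebra n w R"
  shows "algebra (ring_of_type_algebra :: 'k ring) (subalg n R)"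
proof -
  interpret S: algebra "ring_of_type_algebra :: 'k ring" "poly_algebra n"
    by (rule poly_algebra_algebra)
  have sr: "subring R (poly_algebra n)"
    and sm: "submodule R (ring_of_type_algebra :: 'k ring) (poly_algebra n)"
    using assms by (auto simp: graded_subalgebra_def)
  have cr: "cring (subalg n R)"
    using S.subcring_iff[of R] S.subcringI'[OF sr] subringE(1)[OF sr] by blast
  have sub: "x \<in> carrier (poly_algebra n)" if "x \<in> R" for x
    using that subringE(1)[OF sr] by blast
  show ?thesis
    by (rule algebraI)
      (use sub submodule.smult_closed[OF sm] cr in
       \<open>auto simp: S.R_cring S.smult_l_distr S.smult_r_distr S.smult_assoc1 S.smult_assoc2\<close>)
qed

definition graded_split :: "nat \<Rightarrow> (nat \<Rightarrow> nat) \<Rightarrow> 'k::field mpoly set \<Rightarrow> bool" where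
  "graded_split n w R \<longleftrightarrow>
     (\<exists>\<phi> \<in> module_Hom (subalg n R) (regular_module (poly_algebra n)) (regular_module (subalg n R)).
        (\<forall>d. \<phi> ` poly_piece n w d \<subseteq> R \<inter> poly_piece n w d) \<and>
        (\<forall>r\<in>R. \<phi> r = r))"

end

theory Submission
  imports Defs
begin

text \<open>
  Write \<open>S\<close> for the polynomial ring, \<open>\<Phi> : S \<rightarrow> R\<close> for the splitting, \<open>p\<close> for the characteristic and
  \<open>q = p\<^sup>e\<close>. The two features of \<open>R\<close> behind the theorem are those of a graded direct summand of a
  polynomial ring: every nonzero element is sent to \<open>1\<close> by some \<open>q\<close>-root linear map (strong
  F-regularity), and the modules \<open>R\<^bsup>1/q\<^esup>\<close> are, for all \<open>q\<close> together, made of finitely many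
  pieces. The second is used here in an elementary form that needs no decomposition into
  indecomposables.

  \<^item> A nonzero ideal \<open>J\<close> of \<open>D(R)\<close> contains multiplication by some nonzero \<open>r \<in> R\<close>, because
    commutators with elements of \<open>R\<close> stay in \<open>J\<close> and lower the order
    (\<open>ideal_contains_multiplication\<close>). As \<open>k\<close> is perfect and \<open>R\<close> is finitely generated,
    \<open>R\<^sup>q\<close>-linear endomorphisms of \<open>R\<close> are differential operators (\<open>semilinear_is_diff_op\<close>). So it is
    enough to write the identity of \<open>R\<close> as a finite sum of maps \<open>f \<circ> r \<circ> g\<close> with \<open>f\<close> and \<open>g\<close>
    both \<open>R\<^sup>q\<close>-linear for one \<open>q\<close> (\<open>identity_factors\<close>).

  \<^item> \<open>S\<close> is free over \<open>S\<^sup>q\<close> on the monomials \<open>x\<^sup>a\<close> with exponents below \<open>q\<close>. Let \<open>v\<^sub>a : R \<rightarrow> S\<close> take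
    the \<open>q\<close>-th root of the \<open>a\<close>-th coordinate and \<open>u\<^sub>a s = \<Phi> (x\<^sup>a s\<^sup>q)\<close>. Then \<open>id = \<Sum>\<^sub>a u\<^sub>a v\<^sub>a\<close>, hence
    \<open>id = \<Sum>\<^sub>a\<^sub>b u\<^sub>a (v\<^sub>a u\<^sub>b) v\<^sub>b\<close>, where \<open>v\<^sub>a u\<^sub>b : S \<rightarrow> S\<close> is \<open>R\<close>-linear and raises degrees by at most
    the sum of the weights, independently of \<open>q\<close>. Since \<open>R\<close> is finitely generated, all \<open>v\<^sub>b\<close> map into
    the \<open>R\<close>-span of the monomials of degree at most some \<open>B\<close>, again independently of \<open>q\<close>.

  \<^item> An \<open>R\<close>-linear map on that span is determined by finitely many values, so the maps with the
    given degree bound form a finite-dimensional space. The maps that are sums of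
    composites \<open>S \<rightarrow> R \<rightarrow> S\<close> of a \<open>q\<close>-power and a \<open>q\<close>-root linear map form a subspace which grows
    with \<open>q\<close>, as \<open>R\<close> is Frobenius split. Thus it is constant from some \<open>q\<^sub>0\<close> on
    (\<open>factoring_stabilizes\<close>), and for \<open>q = q\<^sub>0 q\<^sub>1\<close> each \<open>v\<^sub>a u\<^sub>b\<close> agrees on the span with a
    sum of composites \<open>v' u'\<close> at level \<open>q\<^sub>0\<close>. This leaves \<open>q\<^sub>1\<close> free: it is chosen so large that some
    \<open>q\<^sub>1\<close>-root linear \<open>\<psi> : R \<rightarrow> R\<close> has \<open>\<psi> r = 1\<close> (\<open>frobenius_splitting\<close>). Then
    \<open>y = \<psi> (r y\<^bsup>q\<^sub>1\<^esup>)\<close> can be inserted between \<open>v'\<close> and \<open>u'\<close>, and the resulting outer maps are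
    \<open>R\<^sup>q\<close>-linear.
\<close>

section \<open>Roots in perfect fields\<close>

lemma exists_irreducible_factor:
  fixes f :: "'k::field poly"
  assumes "Polynomial.degree f > 0"
  obtains g where "Factorial_Ring.irreducible g" "g dvd f"
proof -
  obtain g where g: "g dvd f" "Polynomial.degree g > 0"
    and min: "\<And>h. h dvd f \<and> Polynomial.degree h > 0 \<Longrightarrow> Polynomial.degree g \<le> Polynomial.degree h"
    using ex_has_least_nat[of "\<lambda>g. g dvd f \<and> Polynomial.degree g > 0" f Polynomial.degree] assms
    by auto
  have "g \<noteq> 0" using g by auto
  have "Factorial_Ring.irreducible g"
  proof (rule Factorial_Ring.irreducibleI)
    show "g \<noteq> 0" by fact
    show "\<not> is_unit g" using g \<open>g \<noteq> 0\<close> by (simp add: is_unit_iff_degree)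
  next
    fix a b assume ab: "g = a * b"
    then have nz: "a \<noteq> 0" "b \<noteq> 0" using \<open>g \<noteq> 0\<close> by auto
    have "Polynomial.degree g = Polynomial.degree a + Polynomial.degree b"
      using nz ab by (simp add: degree_mult_eq)
    moreover have "Polynomial.degree a > 0 \<Longrightarrow> Polynomial.degree g \<le> Polynomial.degree a"
      using min[of a] ab g dvd_trans[of a g f] by simp
    ultimately have "Polynomial.degree a = 0 \<or> Polynomial.degree b = 0" by presburger
    then show "is_unit a \<or> is_unit b" using nz by (simp add: is_unit_iff_degree)
  qed
  then show ?thesis using that g by blast
qed

text \<open>
  Let \<open>g\<close> be an irreducible factor of \<open>f = Y\<^sup>p - c\<close>, say \<open>f = g\<^sup>m h\<close> with \<open>h\<close> not divisible by \<open>g\<close>. Since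
  \<open>f' = 0\<close> and, by perfectness, \<open>g\<close> does not divide \<open>g'\<close>, the product rule forces \<open>p\<close> to divide \<open>m\<close>. As \<open>deg f = p\<close>, this makes \<open>g\<close> linear, and
  its root is a \<open>p\<close>-th root of \<open>c\<close>.
\<close>
lemma perfect_field_root:
  fixes c :: "'k::field"
  assumes perf: "perfect_field TYPE('k)" and p: "CHAR('k) > 0"
  shows "\<exists>d. d ^ CHAR('k) = c"
proof -
  define p where "p = CHAR('k)"
  have pp: "prime p" unfolding p_def using p by (rule prime_CHAR_semidom)
  define f where "f = [:- c:] + Polynomial.monom 1 p"
  have p1: "p > 1" using pp prime_gt_1_nat by blast
  have degf: "Polynomial.degree f = p"
    unfolding f_def using p1 by (simp add: degree_add_eq_right degree_monom_eq)
  have ppoly: "of_nat p = (0 :: 'k poly)"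
    unfolding p_def by (metis of_nat_CHAR semiring_char_poly)
  have df: "Polynomial.pderiv f = 0"
    unfolding f_def by (simp add: pderiv_add pderiv_monom pderiv_pCons p_def)
  obtain g where irr: "Factorial_Ring.irreducible g" and gf: "g dvd f"
    using exists_irreducible_factor[of f] degf p1 by auto
  have g0: "g \<noteq> 0" "\<not> is_unit g" using irr by (auto dest: irreducible_not_unit)
  have prime: "prime_elem g" using irr by (rule field_poly_irreducible_imp_prime)
  have cop: "\<not> g dvd Polynomial.pderiv g"
    using perf irr g0 unfolding perfect_field_def by (metis coprime_common_divisor dvd_refl)
  have f0: "f \<noteq> 0" using degf p1 by auto
  have bound: "m \<le> p" if "g ^ m dvd f" for m
  proof -
    have "Polynomial.degree g > 0" using g0 by (simp add: is_unit_iff_degree)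
    then have "m \<le> Polynomial.degree (g ^ m)" using g0 by (simp add: degree_power_eq)
    also have "\<dots> \<le> p" using dvd_imp_degree_le[OF that f0] degf by simp
    finally show ?thesis .
  qed
  define m where "m = (GREATEST m. g ^ m dvd f)"
  have "g ^ m dvd f" unfolding m_def by (rule GreatestI_nat[of _ 0 p]) (use bound in auto)
  then obtain h where fh: "f = g ^ m * h" ..
  have gh: "\<not> g dvd h"
  proof
    assume "g dvd h"
    then have "g ^ Suc m dvd f" unfolding fh by (auto simp: mult_ac)
    then have "Suc m \<le> m"
      unfolding m_def by (rule Greatest_le_nat) (use bound in auto)
    then show False by simp
  qed
  have "m \<noteq> 0"
  proof
    assume "m = 0"
    then have "f = h" using fh by simp
    with gf gh show False by simp
  qed
  then obtain l where l: "m = Suc l" by (cases m) auto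
  have "0 = Polynomial.pderiv (g ^ Suc l * h)" using df fh by (simp add: l)
  also have "\<dots> = g ^ l * (of_nat m * Polynomial.pderiv g * h + g * Polynomial.pderiv h)"
    unfolding pderiv_mult pderiv_power_Suc l
    by (simp add: algebra_simps of_nat_poly del: of_nat_Suc)
  finally have "of_nat m * Polynomial.pderiv g * h = g * (- Polynomial.pderiv h)"
    using g0 by (simp add: eq_neg_iff_add_eq_0)
  then have "g dvd of_nat m * (Polynomial.pderiv g * h)" by (metis dvd_triv_left mult.assoc)
  then have "g dvd of_nat m"
    using prime cop gh by (auto simp: prime_elem_dvd_mult_iff)
  have "of_nat m = (0::'k)"
  proof (rule ccontr)
    assume "of_nat m \<noteq> (0::'k)"
    then have "is_unit (of_nat m :: 'k poly)" by (simp add: of_nat_poly is_unit_const_poly_iff dvd_field_iff)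
    with \<open>g dvd of_nat m\<close> show False using g0 dvd_trans by blast
  qed
  then have "p dvd m" by (simp add: of_nat_eq_0_iff_char_dvd p_def)
  then have "p \<le> m" using l by (auto intro: dvd_imp_le)
  have h0: "h \<noteq> 0" using gh by auto
  have "p = m * Polynomial.degree g + Polynomial.degree h"
    using degf fh g0 h0 by (simp add: degree_mult_eq degree_power_eq)
  moreover have "Polynomial.degree g > 0" using g0 by (simp add: is_unit_iff_degree)
  ultimately have "Polynomial.degree g = 1"
    using \<open>p \<le> m\<close> p1 by (cases "Polynomial.degree g"; cases "Polynomial.degree g - 1") auto
  then obtain a b where ab: "g = [:b, a:]" "a \<noteq> 0" using degree1_coeffs by metis
  then have "poly g (- b / a) = 0" by simp
  then have "poly f (- b / a) = 0" using gf by (metis poly_eq_0_iff_dvd dvd_trans)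
  then have "(- b / a) ^ p = c" by (simp add: f_def poly_monom)
  then show ?thesis unfolding p_def by blast
qed

section \<open>Terms, degrees and homogeneous components\<close>

abbreviation "pkeys \<equiv> Poly_Mapping.keys"
abbreviation "plookup \<equiv> Poly_Mapping.lookup"
abbreviation "mterm \<equiv> Poly_Mapping.single"

lemma poly_mapping_sum_terms: "f = (\<Sum>m\<in>pkeys f. mterm m (plookup f m))"
proof (rule poly_mapping_eqI)
  fix k
  have "plookup (\<Sum>m\<in>pkeys f. mterm m (plookup f m)) k = (\<Sum>m\<in>pkeys f. if m = k then plookup f m else 0)"
    by (simp add: lookup_sum lookup_single when_def)
  also have "\<dots> = plookup f k" by (simp add: in_keys_iff)
  finally show "plookup f k = plookup (\<Sum>m\<in>pkeys f. mterm m (plookup f m)) k" ..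
qed

text \<open>
  The premise on the terms \<open>mterm m c\<close> remembers that \<open>m\<close> occurs in the given \<open>f\<close>, so that
  statements about restricted sets of monomials can be proved with it.
\<close>
lemma poly_mapping_term_induct [case_names single add]:
  fixes f :: "'a \<Rightarrow>\<^sub>0 'b::comm_monoid_add"
  assumes single: "\<And>m c. m \<in> pkeys f \<or> c = 0 \<Longrightarrow> P (mterm m c)"
    and add: "\<And>f g. P f \<Longrightarrow> P g \<Longrightarrow> P (f + g)"
  shows "P f"
proof -
  have "P (\<Sum>m\<in>A. mterm m (plookup f m))" if "finite A" "A \<subseteq> pkeys f" for A
    using that
  proof (induction A rule: finite_induct)
    case empty
    show ?case using single[of undefined 0] by simp
  next
    case (insert x A)
    then show ?case using single[of x] add by auto
  qed
  from this[of "pkeys f"] show ?thesis by (simp flip: poly_mapping_sum_terms)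
qed

text \<open>
  The additive map with prescribed values on single terms; the coordinate maps below, where the
  coefficient enters through a \<open>q\<close>-th root, are of this kind.
\<close>
definition term_extend :: "('a \<Rightarrow> 'b::comm_monoid_add \<Rightarrow> 'c::comm_monoid_add) \<Rightarrow> ('a \<Rightarrow>\<^sub>0 'b) \<Rightarrow> 'c" where
  "term_extend h f = (\<Sum>m\<in>pkeys f. h m (plookup f m))"

lemma term_extend_add:
  assumes "\<And>m. h m 0 = 0" "\<And>m a b. h m (a + b) = h m a + h m b"
  shows "term_extend h (f + g) = term_extend h f + term_extend h g"
  unfolding term_extend_def by (rule setsum_keys_plus_distrib) (use assms in auto)

lemma term_extend_single:
  assumes "\<And>m. h m 0 = 0"
  shows "term_extend h (mterm m c) = h m c"
  using assms by (simp add: term_extend_def)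

definition restrict_keys :: "('a \<Rightarrow> bool) \<Rightarrow> ('a \<Rightarrow>\<^sub>0 'b::zero) \<Rightarrow> ('a \<Rightarrow>\<^sub>0 'b)" where
  "restrict_keys Q f = Poly_Mapping.mapp (\<lambda>m c. if Q m then c else 0) f"

lemma lookup_restrict_keys: "plookup (restrict_keys Q f) m = (if Q m then plookup f m else 0)"
  by (auto simp: restrict_keys_def lookup_mapp when_def in_keys_iff)

lemma keys_restrict_keys: "pkeys (restrict_keys Q f) = {m \<in> pkeys f. Q m}"
  by (auto simp: in_keys_iff lookup_restrict_keys split: if_splits)

lemma restrict_keys_add:
  "restrict_keys Q (f + g) = restrict_keys Q f + restrict_keys Q (g :: _ \<Rightarrow>\<^sub>0 _::monoid_add)"
  by (rule poly_mapping_eqI) (simp add: lookup_restrict_keys lookup_add)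

lemma restrict_keys_single: "restrict_keys Q (mterm m c) = (if Q m then mterm m c else 0)"
  by (rule poly_mapping_eqI) (auto simp: lookup_restrict_keys lookup_single when_def)

lemma restrict_keys_id: "(\<And>m. m \<in> pkeys f \<Longrightarrow> Q m) \<Longrightarrow> restrict_keys Q f = f"
  by (rule poly_mapping_eqI) (auto simp: lookup_restrict_keys in_keys_iff)

text \<open>
  Both projections used below are of this kind: for homogeneous \<open>g\<close> the degree condition is shifted by
  the degree of \<open>g\<close>, and for \<open>g\<close> in the first variables the condition on variables is unchanged.
\<close>
lemma restrict_keys_mult:
  fixes f g :: "'a::comm_monoid_add \<Rightarrow>\<^sub>0 'b::comm_semiring_0"
  assumes "\<And>s m. s \<in> pkeys g \<Longrightarrow> Q (s + m) \<longleftrightarrow> Q' m"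
  shows "restrict_keys Q (g * f) = g * restrict_keys Q' f"
proof (induction g rule: poly_mapping_term_induct)
  case (single s c)
  have "restrict_keys Q (mterm s c * f) = mterm s c * restrict_keys Q' f"
  proof (induction f rule: poly_mapping_term_induct)
    case (single m d)
    then show ?case
      using \<open>s \<in> pkeys g \<or> c = 0\<close> assms[of s m]
      by (auto simp: mult_single restrict_keys_single restrict_keys_id)
  qed (simp add: restrict_keys_add distrib_left)
  then show ?case .
qed (simp add: restrict_keys_add distrib_right)

lemma wdeg_superset:
  assumes "finite A" "pkeys m \<subseteq> A"
  shows "wdeg w m = (\<Sum>i\<in>A. w i * plookup m i)"
  unfolding wdeg_def by (rule sum.mono_neutral_left) (use assms in \<open>auto simp: in_keys_iff\<close>)

lemma wdeg_add: "wdeg w (a + b) = wdeg w a + wdeg w b"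
proof -
  let ?A = "pkeys a \<union> pkeys b"
  have "wdeg w (a + b) = (\<Sum>i\<in>?A. w i * plookup (a + b) i)"
    by (rule wdeg_superset) (use Poly_Mapping.keys_add[of a b] in auto)
  then show ?thesis
    by (simp add: wdeg_superset[of ?A a] wdeg_superset[of ?A b] lookup_add algebra_simps sum.distrib)
qed

lemma wdeg_zero [simp]: "wdeg w 0 = 0"
  by (simp add: wdeg_def)

definition deg_le :: "(nat \<Rightarrow> nat) \<Rightarrow> nat \<Rightarrow> 'k::field mpoly \<Rightarrow> bool" where
  "deg_le w d f \<longleftrightarrow> (\<forall>m\<in>pkeys f. wdeg w m \<le> d)"

lemma deg_le_add: "deg_le w d f \<Longrightarrow> deg_le w d g \<Longrightarrow> deg_le w d (f + g)"
  using Poly_Mapping.keys_add[of f g] by (auto simp: deg_le_def)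

lemma deg_le_mono: "deg_le w d f \<Longrightarrow> d \<le> d' \<Longrightarrow> deg_le w d' f"
  by (fastforce simp: deg_le_def)

lemma deg_le_0 [simp]: "deg_le w d 0"
  by (simp add: deg_le_def)

lemma deg_le_1 [simp]: "deg_le w d 1"
  by (simp add: deg_le_def)

lemma deg_le_single: "wdeg w m \<le> d \<Longrightarrow> deg_le w d (mterm m c)"
  by (simp add: deg_le_def)

lemma deg_le_mult:
  assumes "deg_le w d f" "deg_le w e g"
  shows "deg_le w (d + e) (f * g)"
  unfolding deg_le_def
proof
  fix m assume "m \<in> pkeys (f * g)"
  then obtain a b where "m = a + b" "a \<in> pkeys f" "b \<in> pkeys g" using keys_mult[of f g] by blast
  then show "wdeg w m \<le> d + e" using assms by (auto simp: deg_le_def wdeg_add intro: add_mono)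
qed

lemma deg_le_power: "deg_le w d f \<Longrightarrow> deg_le w (n * d) (f ^ n)"
  by (induction n) (auto intro: deg_le_mult)

lemma deg_le_prod: "(\<And>i. i \<in> A \<Longrightarrow> deg_le w (d i) (f i)) \<Longrightarrow> deg_le w (\<Sum>i\<in>A. d i) (\<Prod>i\<in>A. f i)"
  by (induction A rule: infinite_finite_induct) (auto intro: deg_le_mult)

lemma deg_le_sum: "(\<And>i. i \<in> A \<Longrightarrow> deg_le w d (f i)) \<Longrightarrow> deg_le w d (\<Sum>i\<in>A. f i)"
  by (induction A rule: infinite_finite_induct) (auto intro: deg_le_add)

lemma deg_le_exists: "\<exists>d. deg_le w d f"
proof -
  have "deg_le w (Max (wdeg w ` pkeys f)) f"
    by (auto simp: deg_le_def)
  then show ?thesis ..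
qed

abbreviation vars_lt :: "nat \<Rightarrow> 'k::field mpoly set" where
  "vars_lt n \<equiv> carrier (poly_algebra n)"

lemma vars_lt_iff: "f \<in> vars_lt n \<longleftrightarrow> (\<forall>m\<in>pkeys f. pkeys m \<subseteq> {..<n})"
  by (simp add: poly_algebra_def)

lemma keys_add_nat: "pkeys (a + b) = pkeys a \<union> pkeys (b :: _ \<Rightarrow>\<^sub>0 nat)"
  by (auto simp: in_keys_iff lookup_add)

lemma vars_lt_add: "f \<in> vars_lt n \<Longrightarrow> g \<in> vars_lt n \<Longrightarrow> f + g \<in> vars_lt n"
  unfolding vars_lt_iff using Poly_Mapping.keys_add[of f g] by blast

lemma vars_lt_diff: "f \<in> vars_lt n \<Longrightarrow> g \<in> vars_lt n \<Longrightarrow> f - g \<in> vars_lt n"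
  unfolding vars_lt_iff using keys_diff[of f g] by blast

lemma vars_lt_mult:
  assumes "f \<in> vars_lt n" "g \<in> vars_lt n"
  shows "f * g \<in> vars_lt n"
  unfolding vars_lt_iff
proof
  fix m assume "m \<in> pkeys (f * g)"
  then obtain a b where "m = a + b" "a \<in> pkeys f" "b \<in> pkeys g" using keys_mult[of f g] by blast
  then show "pkeys m \<subseteq> {..<n}" using assms by (auto simp: vars_lt_iff keys_add_nat)
qed

lemma vars_lt_zero: "0 \<in> vars_lt n"
  by (simp add: vars_lt_iff)

lemma vars_lt_single: "pkeys m \<subseteq> {..<n} \<Longrightarrow> mterm m c \<in> vars_lt n"
  by (simp add: vars_lt_iff)

text \<open>
  Setting the variables from the \<open>n\<close>-th on to zero. Composing with this projection makes the
  splitting a total map on all polynomials.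
\<close>
definition drop_vars :: "nat \<Rightarrow> 'k::field mpoly \<Rightarrow> 'k mpoly" where
  "drop_vars n = restrict_keys (\<lambda>m. pkeys m \<subseteq> {..<n})"

lemma drop_vars_add: "drop_vars n (f + g) = drop_vars n f + drop_vars n g"
  by (simp add: drop_vars_def restrict_keys_add)

lemma drop_vars_mult: "r \<in> vars_lt n \<Longrightarrow> drop_vars n (r * f) = r * drop_vars n f"
  unfolding drop_vars_def by (rule restrict_keys_mult) (auto simp: vars_lt_iff keys_add_nat)

lemma drop_vars_in: "drop_vars n f \<in> vars_lt n"
  by (auto simp: vars_lt_iff drop_vars_def keys_restrict_keys)

lemma drop_vars_id: "f \<in> vars_lt n \<Longrightarrow> drop_vars n f = f"
  by (auto simp: vars_lt_iff drop_vars_def intro!: restrict_keys_id)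

definition homogeneous :: "(nat \<Rightarrow> nat) \<Rightarrow> nat \<Rightarrow> 'k::field mpoly \<Rightarrow> bool" where
  "homogeneous w d f \<longleftrightarrow> (\<forall>m\<in>pkeys f. wdeg w m = d)"

lemma hom_component_restrict: "hom_component w d = restrict_keys (\<lambda>m. wdeg w m = d)"
  by (rule ext) (simp add: hom_component_def restrict_keys_def)

lemma homogeneous_hom_component: "homogeneous w d (hom_component w d f)"
  by (simp add: homogeneous_def hom_component_restrict keys_restrict_keys)

lemma hom_component_add: "hom_component w d (f + g) = hom_component w d f + hom_component w d g"
  by (simp add: hom_component_restrict restrict_keys_add)

lemma hom_component_id: "homogeneous w d f \<Longrightarrow> hom_component w d f = f"
  unfolding hom_component_restrict homogeneous_def by (rule restrict_keys_id) auto

lemma hom_component_0: "hom_component w d 0 = 0"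
  by (rule poly_mapping_eqI) (simp add: hom_component_restrict lookup_restrict_keys)

lemma hom_component_sum: "hom_component w d (\<Sum>i\<in>A. f i) = (\<Sum>i\<in>A. hom_component w d (f i))"
  by (induction A rule: infinite_finite_induct) (auto simp: hom_component_add hom_component_0)

lemma hom_component_mult:
  assumes "homogeneous w e g" "e \<le> d"
  shows "hom_component w d (g * f) = g * hom_component w (d - e) f"
  unfolding hom_component_restrict
  by (rule restrict_keys_mult) (use assms in \<open>auto simp: homogeneous_def wdeg_add\<close>)

lemma hom_component_mult_high:
  assumes "homogeneous w e g" "d < e"
  shows "hom_component w d (g * f) = 0"
proof -
  have "hom_component w d (g * f) = g * restrict_keys (\<lambda>_. False) f"
    unfolding hom_component_restrict
    by (rule restrict_keys_mult) (use assms in \<open>auto simp: homogeneous_def wdeg_add\<close>)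
  also have "restrict_keys (\<lambda>_. False) f = 0"
    by (rule poly_mapping_eqI) (simp add: lookup_restrict_keys)
  finally show ?thesis by simp
qed

lemma sum_hom_components:
  assumes "deg_le w D f"
  shows "f = (\<Sum>d\<le>D. hom_component w d f)"
proof (rule poly_mapping_eqI)
  fix m
  have "plookup (\<Sum>d\<le>D. hom_component w d f) m = (\<Sum>d\<le>D. if wdeg w m = d then plookup f m else 0)"
    by (simp add: lookup_sum hom_component_restrict lookup_restrict_keys)
  also have "\<dots> = plookup f m"
    using assms by (cases "m \<in> pkeys f") (auto simp: deg_le_def in_keys_iff)
  finally show "plookup f m = plookup (\<Sum>d\<le>D. hom_component w d f) m" ..
qed

lemma finite_monomials_le: "finite {m::nat \<Rightarrow>\<^sub>0 nat. pkeys m \<subseteq> {..<n} \<and> (\<forall>i. plookup m i \<le> N)}"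
proof -
  have "finite {f. \<forall>i. (i \<in> {..<n} \<longrightarrow> f i \<in> {..N}) \<and> (i \<notin> {..<n} \<longrightarrow> f i = (0::nat))}"
    by (rule finite_set_of_finite_funs) auto
  moreover have "plookup ` {m. pkeys m \<subseteq> {..<n} \<and> (\<forall>i. plookup m i \<le> N)} \<subseteq>
      {f. \<forall>i. (i \<in> {..<n} \<longrightarrow> f i \<in> {..N}) \<and> (i \<notin> {..<n} \<longrightarrow> f i = (0::nat))}"
    by (auto simp: in_keys_iff)
  ultimately have "finite (plookup ` {m. pkeys m \<subseteq> {..<n} \<and> (\<forall>i. plookup m i \<le> N)})"
    by (rule rev_finite_subset)
  then show ?thesis
    by (rule finite_imageD) (rule inj_onI, simp only: poly_mapping_eq_iff)
qed

definition monomials_deg_le :: "nat \<Rightarrow> (nat \<Rightarrow> nat) \<Rightarrow> nat \<Rightarrow> (nat \<Rightarrow>\<^sub>0 nat) set" where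
  "monomials_deg_le n w d = {m. pkeys m \<subseteq> {..<n} \<and> wdeg w m \<le> d}"

lemma lookup_le_wdeg:
  assumes "pkeys m \<subseteq> {..<n}" "\<And>i. i < n \<Longrightarrow> w i > 0"
  shows "plookup m i \<le> wdeg w m"
proof (cases "i \<in> pkeys m")
  case True
  then have "w i > 0" using assms by blast
  then have "plookup m i \<le> w i * plookup m i" by simp
  also have "\<dots> \<le> wdeg w m"
    unfolding wdeg_def by (rule member_le_sum[where f = "\<lambda>i. w i * plookup m i"]) (use True in simp_all)
  finally show ?thesis .
qed (simp add: in_keys_iff)

lemma finite_monomials_deg_le:
  assumes "\<And>i. i < n \<Longrightarrow> w i > 0"
  shows "finite (monomials_deg_le n w d)"
  by (rule finite_subset[OF _ finite_monomials_le[of n d]])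
    (auto simp: monomials_deg_le_def intro: order_trans[OF lookup_le_wdeg[OF _ assms]])

section \<open>Noetherianity via leading monomials\<close>

text \<open>A monotone subsequence that is decreasing is eventually constant.\<close>
lemma nat_incseq_subseq:
  fixes f :: "nat \<Rightarrow> nat"
  obtains r where "strict_mono r" "incseq (\<lambda>i. f (r i))"
proof -
  obtain g where g: "strict_mono g" "monoseq (\<lambda>i. f (g i))" using seq_monosub[of f] by blast
  show ?thesis
  proof (cases "incseq (\<lambda>i. f (g i))")
    case False
    then have dec: "decseq (\<lambda>i. f (g i))" using g(2) by (auto simp: monoseq_iff)
    obtain i where i: "\<And>j. f (g i) \<le> f (g j)"
      using ex_has_least_nat[of "\<lambda>_. True" 0 "\<lambda>i. f (g i)"] by auto
    have "f (g (i + k)) = f (g i)" for k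
      using i[of "i + k"] decseqD[OF dec, of i "i + k"] by simp
    then have "incseq (\<lambda>k. f (g (i + k)))" by (simp add: incseq_def)
    moreover have "strict_mono (\<lambda>k. g (i + k))" using g(1) by (simp add: strict_mono_def)
    ultimately show ?thesis using that by blast
  qed (use that g in blast)
qed

text \<open>Pass to a subsequence on which one further exponent is nondecreasing, \<open>n\<close> times.\<close>
lemma dickson:
  fixes a :: "nat \<Rightarrow> (nat \<Rightarrow>\<^sub>0 nat)"
  assumes "\<And>i. pkeys (a i) \<subseteq> {..<n}"
  obtains i j where "i < j" "\<And>x. plookup (a i) x \<le> plookup (a j) x"
proof -
  have "\<exists>r. strict_mono r \<and> (\<forall>x<n. incseq (\<lambda>i. plookup (a (r i)) x))"
  proof (induction n)
    case 0
    show ?case by (auto intro!: exI[of _ "\<lambda>i. i"] simp: strict_mono_def)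
  next
    case (Suc n)
    then obtain r where r: "strict_mono r" "\<And>x. x < n \<Longrightarrow> incseq (\<lambda>i. plookup (a (r i)) x)" by auto
    obtain s where s: "strict_mono s" "incseq (\<lambda>i. plookup (a (r (s i))) n)"
      using nat_incseq_subseq[of "\<lambda>i. plookup (a (r i)) n"] by auto
    have "incseq (\<lambda>i. plookup (a (r (s i))) x)" if "x < n" for x
      using r(2)[OF that] s(1) by (auto simp: incseq_def strict_mono_less_eq)
    then have "\<forall>x<Suc n. incseq (\<lambda>i. plookup (a (r (s i))) x)"
      using s(2) by (auto simp: less_Suc_eq)
    then show ?case
      using r(1) s(1) by (intro exI[of _ "\<lambda>i. r (s i)"]) (auto simp: strict_mono_def)
  qed
  then obtain r where r: "strict_mono r" "\<And>x. x < n \<Longrightarrow> incseq (\<lambda>i. plookup (a (r i)) x)" by auto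
  have "plookup (a (r 0)) x \<le> plookup (a (r 1)) x" for x
  proof (cases "x < n")
    case True
    then show ?thesis using r(2)[of x] by (simp add: incseq_def)
  next
    case False
    then have "x \<notin> pkeys (a (r 0))" using assms by blast
    then show ?thesis by (simp add: in_keys_iff)
  qed
  then show ?thesis using that[of "r 0" "r 1"] r(1) by (simp add: strict_mono_def)
qed

lemma lex_le_if_pointwise_le:
  fixes a b :: "nat \<Rightarrow>\<^sub>0 nat"
  assumes "\<And>x. plookup a x \<le> plookup b x"
  shows "a \<le> b"
proof -
  have "\<not> b < a"
    using assms by transfer (auto simp: less_fun_def not_less)
  then show ?thesis by simp
qed

text \<open>
  The order on exponent vectors is the lexicographic one. It refines divisibility, so an infinite
  descending chain in finitely many variables would contradict Dickson's lemma.
\<close>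
lemma monomials_lex_min:
  fixes A :: "(nat \<Rightarrow>\<^sub>0 nat) set"
  assumes "x \<in> A" "\<And>m. m \<in> A \<Longrightarrow> pkeys m \<subseteq> {..<n}"
  obtains m where "m \<in> A" "\<And>m'. m' \<in> A \<Longrightarrow> m \<le> m'"
proof -
  define r where "r = {(a, b). a \<in> A \<and> b \<in> A \<and> a < b}"
  have "wf r"
    unfolding wf_iff_no_infinite_down_chain
  proof
    assume "\<exists>f. \<forall>i. (f (Suc i), f i) \<in> r"
    then obtain f where f: "\<And>i. f i \<in> A" "\<And>i. f (Suc i) < f i" by (auto simp: r_def)
    then obtain i j where ij: "i < j" "\<And>x. plookup (f i) x \<le> plookup (f j) x"
      using dickson[of f n] assms(2) by metis
    then have "f i \<le> f j" by (intro lex_le_if_pointwise_le)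
    moreover have "f j < f i"
      using ij(1) by (induction rule: less_Suc_induct) (use f(2) less_trans in blast)+
    ultimately show False by simp
  qed
  then obtain m where m: "m \<in> A" "\<And>m'. (m', m) \<in> r \<Longrightarrow> m' \<notin> A"
    by (rule wfE_min[OF _ assms(1)]) blast
  have "m \<le> m'" if "m' \<in> A" for m'
    by (rule leI) (use m(2)[of m'] m(1) that in \<open>auto simp: r_def\<close>)
  with m(1) show ?thesis by (rule that)
qed

lemma lookup_term_mult:
  fixes f :: "'a::cancel_comm_monoid_add \<Rightarrow>\<^sub>0 'b::comm_semiring_0"
  shows "plookup (mterm t c * f) (t + m) = c * plookup f m"
  by (induction f rule: poly_mapping_term_induct)
    (auto simp: mult_single lookup_single when_def lookup_add distrib_left)

text \<open>The span of a set in this module is the ideal generated by it.\<close>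
interpretation ideal_span: Modules.module "(*) :: 'k::field mpoly \<Rightarrow> 'k mpoly \<Rightarrow> 'k mpoly"
  by standard (simp_all add: algebra_simps)

(* As a rewrite rule it reassociates products and loops with associativity. *)
declare ideal_span.scale_scale [simp del]

text \<open>The leading monomial; it is only meaningful for nonzero polynomials.\<close>
abbreviation lead :: "'k::field mpoly \<Rightarrow> (nat \<Rightarrow>\<^sub>0 nat)" where
  "lead f \<equiv> Max (pkeys f)"

text \<open>
  Otherwise one can choose \<open>f\<^sub>0, f\<^sub>1, \<dots>\<close> in \<open>I\<close>, each outside the ideal of its predecessors and with
  the least leading monomial possible. By Dickson's lemma some \<open>lead f\<^sub>i\<close> divides \<open>lead f\<^sub>j\<close> with
  \<open>i < j\<close>, and cancelling the leading term of \<open>f\<^sub>j\<close> by a multiple of \<open>f\<^sub>i\<close> contradicts minimality.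
  The hypothesis asks for closure under such reductions only, which keeps \<open>I\<close> inside the polynomials
  in \<open>n\<close> variables while the span is taken over all polynomials.
\<close>
lemma hilbert_basis:
  fixes I :: "'k::field mpoly set"
  assumes sub: "I \<subseteq> vars_lt n"
    and red: "\<And>f g t c. f \<in> I \<Longrightarrow> g \<in> I \<Longrightarrow> pkeys t \<subseteq> {..<n} \<Longrightarrow> f - mterm t c * g \<in> I"
  obtains F where "finite F" "F \<subseteq> I" "I \<subseteq> ideal_span.span F"
proof (rule ccontr)
  assume "\<not> thesis"
  then have no: "\<exists>f. f \<in> I - ideal_span.span F" if "finite F" "F \<subseteq> I" for F
    using that \<open>\<And>F. finite F \<Longrightarrow> F \<subseteq> I \<Longrightarrow> I \<subseteq> ideal_span.span F \<Longrightarrow> thesis\<close> by blast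
  have nz: "f \<noteq> 0" if "f \<in> I - ideal_span.span F" for f F
    using that ideal_span.span_zero by auto
  have lead_in: "lead f \<in> pkeys f" if "f \<noteq> 0" for f :: "'k mpoly"
    using that by (intro Max_in) auto
  have lead_vars: "pkeys (lead f) \<subseteq> {..<n}" if "f \<in> I" "f \<noteq> 0" for f
  proof -
    have "f \<in> vars_lt n" using that sub by blast
    then show ?thesis using lead_in[OF that(2)] unfolding vars_lt_iff by blast
  qed
  have "\<exists>f. f \<in> I - ideal_span.span F \<and> (\<forall>g \<in> I - ideal_span.span F. lead f \<le> lead g)"
    if F: "finite F" "F \<subseteq> I" for F
  proof -
    obtain f where "f \<in> I - ideal_span.span F" using no[OF F] by blast
    then have "lead f \<in> lead ` (I - ideal_span.span F)" by blast
    moreover have "pkeys m \<subseteq> {..<n}" if "m \<in> lead ` (I - ideal_span.span F)" for m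
      using that lead_vars nz by blast
    ultimately obtain m where "m \<in> lead ` (I - ideal_span.span F)"
      "\<And>m'. m' \<in> lead ` (I - ideal_span.span F) \<Longrightarrow> m \<le> m'"
      using monomials_lex_min[of _ "lead ` (I - ideal_span.span F)" n] by metis
    then show ?thesis by (metis (no_types, lifting) imageE imageI)
  qed
  then obtain h where h: "\<And>F. finite F \<Longrightarrow> F \<subseteq> I \<Longrightarrow> h F \<in> I - ideal_span.span F"
    and hmin: "\<And>F g. finite F \<Longrightarrow> F \<subseteq> I \<Longrightarrow> g \<in> I - ideal_span.span F \<Longrightarrow> lead (h F) \<le> lead g"
    by metis
  define G where "G = rec_nat {} (\<lambda>_ F. insert (h F) F)"
  have G_Suc: "G (Suc i) = insert (h (G i)) (G i)" for i by (simp add: G_def)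
  have G: "finite (G i) \<and> G i \<subseteq> I" for i
  proof (induction i)
    case 0
    show ?case by (simp add: G_def)
  next
    case (Suc i)
    then show ?case using h[of "G i"] by (simp add: G_Suc)
  qed
  have G_mono: "G i \<subseteq> G j" if "i \<le> j" for i j
    using that by (rule lift_Suc_mono_le[rotated]) (auto simp: G_Suc)
  define f where "f i = h (G i)" for i
  have f: "f i \<in> I" "f i \<notin> ideal_span.span (G i)" "f i \<noteq> 0" for i
    using h[of "G i"] G[of i] nz unfolding f_def by blast+
  obtain i j where ij: "i < j" and le: "\<And>x. plookup (lead (f i)) x \<le> plookup (lead (f j)) x"
    using dickson[of "\<lambda>i. lead (f i)" n] lead_vars f by blast
  define t where "t = lead (f j) - lead (f i)"
  have t: "t + lead (f i) = lead (f j)"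
    unfolding t_def by (rule poly_mapping_eqI) (use le in \<open>simp add: lookup_add lookup_minus\<close>)
  have "pkeys t \<subseteq> {..<n}"
    using lead_vars[OF f(1,3), of j] unfolding t[symmetric] by (simp add: keys_add_nat)
  define c where "c = plookup (f j) (lead (f j)) / plookup (f i) (lead (f i))"
  define g where "g = f j - mterm t c * f i"
  have "g \<in> I" unfolding g_def using f \<open>pkeys t \<subseteq> {..<n}\<close> by (intro red)
  have "f i \<in> G j" using G_mono[of "Suc i" j] ij by (auto simp: G_Suc f_def)
  then have "mterm t c * f i \<in> ideal_span.span (G j)"
    by (intro ideal_span.span_scale ideal_span.span_base)
  then have "g \<notin> ideal_span.span (G j)"
    using f(2)[of j] ideal_span.span_add[of g "G j" "mterm t c * f i"] by (auto simp: g_def)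
  then have "lead (f j) \<le> lead g"
    using hmin[of "G j" g] G[of j] \<open>g \<in> I\<close> by (simp add: f_def)
  moreover have g_in: "lead g \<in> pkeys g"
    using \<open>g \<notin> ideal_span.span (G j)\<close> ideal_span.span_zero by (intro lead_in) auto
  moreover have "m \<le> lead (f j)" if "m \<in> pkeys g" for m
  proof -
    have "m \<in> pkeys (f j) \<or> m \<in> pkeys (mterm t c * f i)"
      using that keys_diff[of "f j" "mterm t c * f i"] unfolding g_def by blast
    then show ?thesis
    proof
      assume "m \<in> pkeys (mterm t c * f i)"
      then obtain b where "m = t + b" "b \<in> pkeys (f i)"
        using keys_mult[of "mterm t c" "f i"] by (auto split: if_splits)
      then show ?thesis unfolding t[symmetric] by (simp add: add_left_mono)
    qed simp
  qed
  ultimately have "lead (f j) \<in> pkeys g" by (metis order_antisym)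
  moreover have "plookup g (lead (f j)) = 0"
    using lead_in[OF f(3)[of i]] lookup_term_mult[of t c "f i" "lead (f i)"]
    by (simp add: g_def lookup_minus t c_def in_keys_iff)
  ultimately show False by (simp add: in_keys_iff)
qed


section \<open>Graded retracts are finitely generated\<close>

text \<open>The \<open>k\<close>-subalgebra generated by \<open>F\<close>, with products built up one generator at a time.\<close>
inductive_set generated_algebra :: "'k::field mpoly set \<Rightarrow> 'k mpoly set" for F where
  const: "mterm 0 c \<in> generated_algebra F"
| mult: "g \<in> F \<Longrightarrow> r \<in> generated_algebra F \<Longrightarrow> g * r \<in> generated_algebra F"
| add: "r \<in> generated_algebra F \<Longrightarrow> s \<in> generated_algebra F \<Longrightarrow> r + s \<in> generated_algebra F"

lemma generated_algebra_sum:
  assumes "\<And>i. i \<in> A \<Longrightarrow> f i \<in> generated_algebra F"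
  shows "(\<Sum>i\<in>A. f i) \<in> generated_algebra F"
  using assms
proof (induction A rule: infinite_finite_induct)
  case (insert x A)
  then show ?case using generated_algebra.add[of "f x" F "\<Sum>i\<in>A. f i"] by simp
qed (use generated_algebra.const[of 0 F] in simp_all)

text \<open>
  The situation of the theorem in terms of polynomials: the splitting is extended to polynomials in
  all variables, so that \<open>\<Phi>\<close> is additive without side conditions.
\<close>
locale graded_retract =
  fixes n :: nat and w :: "nat \<Rightarrow> nat" and R :: "'k::field mpoly set" and \<Phi> :: "'k mpoly \<Rightarrow> 'k mpoly"
  assumes w_pos: "i < n \<Longrightarrow> w i > 0"
    and R_vars: "r \<in> R \<Longrightarrow> r \<in> vars_lt n"
    and R_const: "mterm 0 c \<in> R"
    and R_add: "r \<in> R \<Longrightarrow> s \<in> R \<Longrightarrow> r + s \<in> R"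
    and R_mult: "r \<in> R \<Longrightarrow> s \<in> R \<Longrightarrow> r * s \<in> R"
    and R_hom: "r \<in> R \<Longrightarrow> hom_component w d r \<in> R"
    and Phi_in: "\<Phi> f \<in> R"
    and Phi_add: "\<Phi> (f + g) = \<Phi> f + \<Phi> g"
    and Phi_mult: "r \<in> R \<Longrightarrow> \<Phi> (r * f) = r * \<Phi> f"
    and Phi_id: "r \<in> R \<Longrightarrow> \<Phi> r = r"
    and Phi_hom: "homogeneous w d f \<Longrightarrow> homogeneous w d (\<Phi> f)"
begin

lemma R_0: "0 \<in> R" using R_const[of 0] by simp
lemma R_1: "1 \<in> R" using R_const[of 1] by simp
lemma R_uminus: "r \<in> R \<Longrightarrow> - r \<in> R"
  using R_mult[OF R_const[of "- 1"], of r] by (simp add: single_uminus)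
lemma R_diff: "r \<in> R \<Longrightarrow> s \<in> R \<Longrightarrow> r - s \<in> R"
  using R_add[of r "- s"] R_uminus[of s] by simp
lemma R_prod: "(\<And>i. i \<in> A \<Longrightarrow> f i \<in> R) \<Longrightarrow> (\<Prod>i\<in>A. f i) \<in> R"
  by (induction A rule: infinite_finite_induct) (auto simp: R_1 R_mult)
lemma R_power: "r \<in> R \<Longrightarrow> r ^ m \<in> R"
  by (induction m) (auto simp: R_1 R_mult)
lemma Phi_0: "\<Phi> 0 = 0" using Phi_id[OF R_0] .
lemma Phi_sum: "\<Phi> (\<Sum>i\<in>A. f i) = (\<Sum>i\<in>A. \<Phi> (f i))"
  by (induction A rule: infinite_finite_induct) (auto simp: Phi_0 Phi_add)

lemma homogeneous_0_const:
  assumes "f \<in> vars_lt n" "homogeneous w 0 f"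
  shows "f = mterm 0 (plookup f 0)"
proof -
  have "m = 0" if m: "m \<in> pkeys f" for m
  proof (rule poly_mapping_eqI)
    fix i
    show "plookup m i = plookup 0 i"
      using m assms lookup_le_wdeg[of m n w i] w_pos by (auto simp: vars_lt_iff homogeneous_def)
  qed
  then have "pkeys f \<subseteq> {0}" by blast
  then show ?thesis
    by (intro poly_mapping_eqI) (auto simp: lookup_single when_def in_keys_iff)
qed

text \<open>
  The ideal of \<open>S\<close> generated by the homogeneous elements of \<open>R\<close> of positive degree is generated by
  finitely many of them. Writing such an element as \<open>r = \<Sum> s\<^sub>g g\<close> and applying \<open>\<Phi>\<close> moves the
  coefficients into \<open>R\<close>: \<open>r = \<Sum> \<Phi> (s\<^sub>g) g\<close>. In the component of degree \<open>deg r\<close> the coefficients have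
  smaller degree than \<open>r\<close>, so induction on the degree applies.
\<close>
theorem finitely_generated: "\<exists>F. finite F \<and> F \<subseteq> R \<and> R \<subseteq> generated_algebra F"
proof -
  define A where "A = {r \<in> R. \<exists>d>0. homogeneous w d r}"
  have A_sub: "A \<subseteq> ideal_span.span A \<inter> vars_lt n"
    using ideal_span.span_superset[of A] R_vars by (auto simp: A_def)
  \<comment> \<open>Spans are taken over polynomials in all variables, hence the intersection with \<open>vars_lt n\<close>.\<close>
  obtain F where F: "finite F" "F \<subseteq> ideal_span.span A \<inter> vars_lt n"
      "ideal_span.span A \<inter> vars_lt n \<subseteq> ideal_span.span F"
  proof (rule hilbert_basis)
    show "ideal_span.span A \<inter> vars_lt n \<subseteq> vars_lt n" by blast
    show "f - mterm t c * g \<in> ideal_span.span A \<inter> vars_lt n"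
      if "f \<in> ideal_span.span A \<inter> vars_lt n" "g \<in> ideal_span.span A \<inter> vars_lt n" "pkeys t \<subseteq> {..<n}"
      for f g t c
      using that
      by (auto intro!: ideal_span.span_diff ideal_span.span_scale vars_lt_diff vars_lt_mult vars_lt_single)
  qed
  have "\<exists>A0. finite A0 \<and> A0 \<subseteq> A \<and> f \<in> ideal_span.span A0" if "f \<in> ideal_span.span A" for f
    using that unfolding ideal_span.span_explicit
    by clarsimp (metis (mono_tags, lifting) mem_Collect_eq subset_refl)
  then obtain a where a: "\<And>f. f \<in> ideal_span.span A \<Longrightarrow> finite (a f) \<and> a f \<subseteq> A \<and> f \<in> ideal_span.span (a f)"
    by metis
  define A0 where "A0 = (\<Union>f\<in>F. a f)"
  have A0: "finite A0" "A0 \<subseteq> A" using F a by (auto simp: A0_def)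
  have "F \<subseteq> ideal_span.span A0"
  proof
    fix f assume f: "f \<in> F"
    then have "f \<in> ideal_span.span (a f)" using F(2) a by blast
    moreover have "a f \<subseteq> A0" using f by (auto simp: A0_def)
    ultimately show "f \<in> ideal_span.span A0" using ideal_span.span_mono by blast
  qed
  then have "ideal_span.span F \<subseteq> ideal_span.span A0"
    by (rule ideal_span.span_minimal) (rule ideal_span.subspace_span)
  then have span: "A \<subseteq> ideal_span.span A0" using F(3) A_sub by blast
  have hom_gen: "r \<in> generated_algebra A0" if "r \<in> R" "homogeneous w d r" for r d
    using that
  proof (induction d arbitrary: r rule: less_induct)
    case (less d)
    show ?case
    proof (cases "d = 0")
      case True
      then show ?thesis
        using homogeneous_0_const[of r] less.prems R_vars generated_algebra.const by metis
    next
      case False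
      then have "r \<in> ideal_span.span A0" using less.prems span by (auto simp: A_def)
      then obtain s where s: "r = (\<Sum>g\<in>A0. s g * g)"
        using ideal_span.span_finite[OF A0(1)] by auto
      have "r = hom_component w d (\<Phi> r)"
        using less.prems by (simp add: Phi_id hom_component_id)
      also have "\<Phi> r = (\<Sum>g\<in>A0. g * \<Phi> (s g))"
        unfolding s Phi_sum
      proof (rule sum.cong[OF refl])
        fix g assume "g \<in> A0"
        then have "g \<in> R" using A0 by (auto simp: A_def)
        then show "\<Phi> (s g * g) = g * \<Phi> (s g)" using Phi_mult[of g "s g"] by (simp add: mult.commute)
      qed
      finally have r: "r = (\<Sum>g\<in>A0. hom_component w d (g * \<Phi> (s g)))"
        by (simp only: hom_component_sum)
      have "hom_component w d (g * \<Phi> (s g)) \<in> generated_algebra A0" if g: "g \<in> A0" for g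
      proof -
        obtain e where e: "e > 0" "homogeneous w e g" using g A0 by (auto simp: A_def)
        show ?thesis
        proof (cases "e \<le> d")
          case True
          have "hom_component w (d - e) (\<Phi> (s g)) \<in> generated_algebra A0"
            by (rule less.IH[of "d - e"]) (use e True R_hom Phi_in homogeneous_hom_component in auto)
          then show ?thesis
            unfolding hom_component_mult[OF e(2) True] using g by (intro generated_algebra.mult)
        next
          case False
          then show ?thesis
            using hom_component_mult_high[OF e(2)] generated_algebra.const[of 0] by simp
        qed
      qed
      then have "(\<Sum>g\<in>A0. hom_component w d (g * \<Phi> (s g))) \<in> generated_algebra A0"
        by (rule generated_algebra_sum)
      then show ?thesis by (simp only: r[symmetric])
    qed
  qed
  have "r \<in> generated_algebra A0" if "r \<in> R" for r
  proof -
    obtain D where "deg_le w D r" using deg_le_exists by blast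
    then have r: "r = (\<Sum>d\<le>D. hom_component w d r)" by (rule sum_hom_components)
    have "(\<Sum>d\<le>D. hom_component w d r) \<in> generated_algebra A0"
      by (rule generated_algebra_sum) (rule hom_gen[OF R_hom[OF that] homogeneous_hom_component])
    then show ?thesis by (simp only: r[symmetric])
  qed
  moreover have "A0 \<subseteq> R" using A0 by (auto simp: A_def)
  ultimately show ?thesis using A0 by blast
qed

lemma Phi_deg_le:
  assumes "deg_le w D f"
  shows "deg_le w D (\<Phi> f)"
proof -
  have "\<Phi> f = (\<Sum>d\<le>D. \<Phi> (hom_component w d f))"
    unfolding Phi_sum[symmetric] using sum_hom_components[OF assms] by simp
  moreover have "deg_le w D (\<Phi> (hom_component w d f))" if "d \<le> D" for d
    using Phi_hom[OF homogeneous_hom_component, of d f] that by (auto simp: deg_le_def homogeneous_def)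
  ultimately show ?thesis by (auto intro: deg_le_sum)
qed

end

section \<open>Coordinates over the subring of powers\<close>

text \<open>
  Used for polynomials, indexed by exponent vectors, and again for polynomials in one auxiliary
  variable over them, indexed by natural numbers.
\<close>
lemma char_poly_mapping: "CHAR('a::comm_monoid_add \<Rightarrow>\<^sub>0 'b::comm_semiring_1) = CHAR('b)"
proof (rule CHAR_eqI)
  show "of_nat CHAR('b) = (0 :: 'a \<Rightarrow>\<^sub>0 'b)"
    by (metis of_nat_CHAR single_of_nat single_zero)
  show "CHAR('b) dvd x" if "of_nat x = (0 :: 'a \<Rightarrow>\<^sub>0 'b)" for x
    using that by (metis lookup_single_eq lookup_zero of_nat_eq_0_iff_char_dvd single_of_nat)
qed

lemma lookup_map: "f 0 = 0 \<Longrightarrow> plookup (Poly_Mapping.map f m) i = f (plookup m i)"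
  by (simp add: Poly_Mapping.map.rep_eq when_def)

definition mono_scale :: "nat \<Rightarrow> (nat \<Rightarrow>\<^sub>0 nat) \<Rightarrow> (nat \<Rightarrow>\<^sub>0 nat)" where
  "mono_scale q = Poly_Mapping.map (\<lambda>x. q * x)"
definition mono_div :: "nat \<Rightarrow> (nat \<Rightarrow>\<^sub>0 nat) \<Rightarrow> (nat \<Rightarrow>\<^sub>0 nat)" where
  "mono_div q = Poly_Mapping.map (\<lambda>x. x div q)"
definition mono_mod :: "nat \<Rightarrow> (nat \<Rightarrow>\<^sub>0 nat) \<Rightarrow> (nat \<Rightarrow>\<^sub>0 nat)" where
  "mono_mod q = Poly_Mapping.map (\<lambda>x. x mod q)"

lemma lookup_mono [simp]:
  "plookup (mono_scale q m) i = q * plookup m i"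
  "plookup (mono_div q m) i = plookup m i div q"
  "plookup (mono_mod q m) i = plookup m i mod q"
  by (simp_all add: mono_scale_def mono_div_def mono_mod_def lookup_map)

lemma mono_mod_add: "mono_mod q (mono_scale q s + t) = mono_mod q t"
  by (rule poly_mapping_eqI) (simp add: lookup_add)

lemma mono_div_add: "q > 0 \<Longrightarrow> mono_div q (mono_scale q s + t) = s + mono_div q t"
  by (rule poly_mapping_eqI) (simp add: lookup_add)

lemma mono_mod_div: "mono_mod q t + mono_scale q (mono_div q t) = t"
  by (rule poly_mapping_eqI) (simp add: lookup_add)

lemma keys_mono: "pkeys (mono_div q t) \<subseteq> pkeys t" "pkeys (mono_mod q t) \<subseteq> pkeys t"
  by (auto simp: in_keys_iff intro: ccontr)

lemma wdeg_mono_div: "q * wdeg w (mono_div q t) \<le> wdeg w t"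
proof -
  have "wdeg w (mono_div q t) = (\<Sum>i\<in>pkeys t. w i * (plookup t i div q))"
    using wdeg_superset[of "pkeys t" "mono_div q t" w] keys_mono by simp
  then have "q * wdeg w (mono_div q t) = (\<Sum>i\<in>pkeys t. w i * (q * (plookup t i div q)))"
    by (simp add: sum_distrib_left mult_ac)
  also have "\<dots> \<le> wdeg w t"
    unfolding wdeg_def by (intro sum_mono mult_left_mono) auto
  finally show ?thesis .
qed

lemma term_power: "mterm m c ^ q = mterm (mono_scale q m) (c ^ q)"
proof (induction q)
  case 0
  have "mono_scale 0 m = 0" by (rule poly_mapping_eqI) simp
  then show ?case by simp
next
  case (Suc q)
  have "m + mono_scale q m = mono_scale (Suc q) m"
    by (rule poly_mapping_eqI) (simp add: lookup_add)
  then show ?case by (simp add: Suc mult_single)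
qed

locale perfect_char =
  fixes p :: nat and K :: "'k::field itself"
  assumes p_char: "p = CHAR('k)" and p_prime: "prime p" and root_ex: "\<exists>d. d ^ p = (c :: 'k)"
begin

lemma p_gt_1: "p > 1" using p_prime prime_gt_1_nat by blast
lemma p_pos [simp]: "p > 0" "p \<noteq> 0" using p_gt_1 by simp_all

lemma frob_add: "(x + y :: 'k) ^ (p ^ e) = x ^ (p ^ e) + y ^ (p ^ e)"
  by (rule freshmans_dream') (use p_prime p_char in auto)

lemma frob_add_mpoly: "(x + y :: 'k mpoly) ^ (p ^ e) = x ^ (p ^ e) + y ^ (p ^ e)"
  by (rule freshmans_dream'[where n = e]) (use p_prime in \<open>simp_all add: char_poly_mapping p_char\<close>)

lemma frob_inj: "x ^ (p ^ e) = y ^ (p ^ e) \<Longrightarrow> x = (y :: 'k)"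
proof -
  assume "x ^ (p ^ e) = y ^ (p ^ e)"
  then have "(x - y) ^ (p ^ e) = 0"
    using frob_add[of "x - y" y e] by simp
  then show "x = y" by simp
qed

lemma frob_surj: "\<exists>d. d ^ (p ^ e) = (c :: 'k)"
proof (induction e arbitrary: c)
  case (Suc e)
  then obtain b d where "b ^ p = c" "d ^ (p ^ e) = b" using root_ex by meson
  then have "d ^ (p ^ Suc e) = c" using power_mult[of d "p ^ e" p] by (simp add: mult.commute)
  then show ?case ..
qed simp

text \<open>The inverse of the \<open>e\<close>-th iterate of the Frobenius map.\<close>
definition frob_root :: "nat \<Rightarrow> 'k \<Rightarrow> 'k" where
  "frob_root e c = (SOME d. d ^ (p ^ e) = c)"

lemma frob_root_power [simp]: "frob_root e c ^ (p ^ e) = c"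
  unfolding frob_root_def by (rule someI_ex) (rule frob_surj)

lemma frob_root_eqI: "d ^ (p ^ e) = c \<Longrightarrow> frob_root e c = d"
  by (rule frob_inj[of _ e]) simp

lemma frob_root_0 [simp]: "frob_root e 0 = 0"
  by (rule frob_root_eqI) simp
lemma frob_root_1 [simp]: "frob_root e 1 = 1"
  by (rule frob_root_eqI) simp
lemma frob_root_add: "frob_root e (a + b) = frob_root e a + frob_root e b"
  by (rule frob_root_eqI) (simp add: frob_add)
lemma frob_root_mult: "frob_root e (a ^ (p ^ e) * b) = a * frob_root e b"
  by (rule frob_root_eqI) (simp add: power_mult_distrib)

text \<open>
  Over the subring of \<open>p\<^sup>e\<close>-th powers, the polynomials are free on the monomials with all exponents
  below \<open>p\<^sup>e\<close>. This is the \<open>p\<^sup>e\<close>-th root of the coordinate at the basis monomial with exponent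
  vector \<open>a\<close>.
\<close>
definition frob_coeff :: "nat \<Rightarrow> (nat \<Rightarrow>\<^sub>0 nat) \<Rightarrow> 'k mpoly \<Rightarrow> 'k mpoly" where
  "frob_coeff e a = term_extend (\<lambda>m c.
     if mono_mod (p ^ e) m = a then mterm (mono_div (p ^ e) m) (frob_root e c) else 0)"

lemma frob_coeff_add: "frob_coeff e a (f + g) = frob_coeff e a f + frob_coeff e a g"
  unfolding frob_coeff_def by (rule term_extend_add) (auto simp: frob_root_add single_add)

lemma frob_coeff_single: "frob_coeff e a (mterm m c) =
    (if mono_mod (p ^ e) m = a then mterm (mono_div (p ^ e) m) (frob_root e c) else 0)"
  unfolding frob_coeff_def by (rule term_extend_single) auto

lemma frob_coeff_0: "frob_coeff e a 0 = 0"
  using frob_coeff_single[of e a 0 0] by simp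

lemma frob_coeff_mult: "frob_coeff e a (r ^ (p ^ e) * x) = r * frob_coeff e a x"
proof (induction r rule: poly_mapping_term_induct)
  case (single s c)
  show ?case
  proof (induction x rule: poly_mapping_term_induct)
    case (single t d)
    show ?case
      by (simp add: term_power mult_single frob_coeff_single mono_mod_add mono_div_add frob_root_mult)
  qed (simp add: distrib_left frob_coeff_add)
qed (simp add: frob_add_mpoly distrib_right frob_coeff_add)

lemma frob_coeff_terms:
  assumes "P 0" "\<And>f g. P f \<Longrightarrow> P g \<Longrightarrow> P (f + g)"
    and "\<And>m c. m \<in> pkeys f \<Longrightarrow> P (mterm (mono_div (p ^ e) m) c)"
  shows "P (frob_coeff e a f)"
proof -
  have "P (frob_coeff e a f)"
  proof (induction f rule: poly_mapping_term_induct)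
    case (single m c)
    then show ?case using assms by (auto simp: frob_coeff_single)
  qed (simp add: frob_coeff_add assms)
  then show ?thesis .
qed

lemma frob_coeff_vars:
  assumes "f \<in> vars_lt n"
  shows "frob_coeff e a f \<in> vars_lt n"
proof (rule frob_coeff_terms)
  fix m c assume "m \<in> pkeys f"
  then have "pkeys (mono_div (p ^ e) m) \<subseteq> {..<n}"
    using assms keys_mono(1)[of "p ^ e" m] unfolding vars_lt_iff by blast
  then show "mterm (mono_div (p ^ e) m) c \<in> vars_lt n" by (rule vars_lt_single)
qed (rule vars_lt_zero vars_lt_add; assumption?)+

lemma frob_coeff_deg_le:
  assumes "deg_le w (p ^ e * d) f"
  shows "deg_le w d (frob_coeff e a f)"
proof (rule frob_coeff_terms)
  fix m c assume "m \<in> pkeys f"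
  then have "p ^ e * wdeg w (mono_div (p ^ e) m) \<le> p ^ e * d"
    using assms wdeg_mono_div[of "p ^ e" w m] unfolding deg_le_def by (blast intro: le_trans)
  then show "deg_le w d (mterm (mono_div (p ^ e) m) c)" by (intro deg_le_single) simp
qed (auto intro: deg_le_add)

definition frob_box :: "nat \<Rightarrow> nat \<Rightarrow> (nat \<Rightarrow>\<^sub>0 nat) set" where
  "frob_box n e = {a. pkeys a \<subseteq> {..<n} \<and> (\<forall>i. plookup a i < p ^ e)}"

lemma finite_frob_box: "finite (frob_box n e)"
  by (rule finite_subset[OF _ finite_monomials_le[of n "p ^ e"]])
    (auto simp: frob_box_def intro: less_imp_le)

text \<open>
  Dividing by \<open>p\<^sup>e\<close> gives a bound on the degrees of the basis elements that is independent of \<open>e\<close>.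
\<close>
lemma wdeg_frob_box:
  assumes "a \<in> frob_box n e"
  shows "wdeg w a \<le> p ^ e * (\<Sum>i<n. w i)"
proof -
  have "wdeg w a = (\<Sum>i<n. w i * plookup a i)"
    using assms by (intro wdeg_superset) (auto simp: frob_box_def)
  also have "\<dots> \<le> (\<Sum>i<n. w i * p ^ e)"
    using assms by (intro sum_mono mult_left_mono) (auto simp: frob_box_def intro: less_imp_le)
  finally show ?thesis by (simp add: sum_distrib_left mult.commute)
qed

lemma frob_expansion:
  assumes "f \<in> vars_lt n"
  shows "f = (\<Sum>a\<in>frob_box n e. mterm a 1 * frob_coeff e a f ^ (p ^ e))"
proof (induction f rule: poly_mapping_term_induct)
  case (single m c)
  have eq: "mterm a 1 * frob_coeff e a (mterm m c) ^ (p ^ e) =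
      (if a = mono_mod (p ^ e) m then mterm m c else 0)" for a
    by (auto simp: frob_coeff_single term_power mult_single mono_mod_div power_0_left)
  show ?case
  proof (cases "c = 0")
    case False
    then have "pkeys m \<subseteq> {..<n}" using single assms unfolding vars_lt_iff by blast
    then have "mono_mod (p ^ e) m \<in> frob_box n e"
      using keys_mono(2)[of "p ^ e" m] by (auto simp: frob_box_def)
    then show ?thesis unfolding eq using finite_frob_box by simp
  qed (simp add: frob_coeff_0 power_0_left)
next
  case (add f g)
  then show ?case
    by (simp add: frob_coeff_add frob_add_mpoly distrib_left sum.distrib)
qed

text \<open>
  When \<open>p\<^sup>e\<close> exceeds all exponents in \<open>r\<close>, the monomials of \<open>r\<close> are basis elements, so the coordinates
  of \<open>r\<close> are constants.
\<close>
lemma frob_coeff_lead: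
  fixes r :: "'k mpoly"
  assumes "r \<noteq> 0"
  obtains e m c where "c \<noteq> 0" "frob_coeff e m r = mterm 0 c"
proof -
  define N where "N = (\<Sum>t\<in>pkeys r. \<Sum>i\<in>pkeys t. plookup t i)"
  have N: "plookup t i \<le> N" if "t \<in> pkeys r" for t i
  proof (cases "i \<in> pkeys t")
    case True
    have "plookup t i \<le> (\<Sum>i\<in>pkeys t. plookup t i)" using True by (intro member_le_sum) auto
    also have "\<dots> \<le> N" unfolding N_def
      using that by (intro member_le_sum[where f = "\<lambda>t. \<Sum>i\<in>pkeys t. plookup t i"]) auto
    finally show ?thesis .
  qed (simp add: in_keys_iff)
  have "N < p ^ N"
    using less_exp[of N] power_mono[of 2 p N] p_gt_1 by linarith
  then have less: "plookup t i < p ^ N" if "t \<in> pkeys r" for t i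
    using N[OF that, of i] by linarith
  have md: "mono_mod (p ^ N) t = t" "mono_div (p ^ N) t = 0" if "t \<in> pkeys r" for t
    using less[OF that] by (auto intro!: poly_mapping_eqI)
  obtain m where m: "m \<in> pkeys r" using assms by (metis all_not_in_conv keys_eq_empty)
  have "frob_coeff N m r = (\<Sum>t\<in>pkeys r. if t = m then mterm 0 (frob_root N (plookup r t)) else 0)"
    unfolding frob_coeff_def term_extend_def by (rule sum.cong) (auto simp: md)
  also have "\<dots> = mterm 0 (frob_root N (plookup r m))" using m by simp
  finally have "frob_coeff N m r = mterm 0 (frob_root N (plookup r m))" .
  moreover have "frob_root N (plookup r m) \<noteq> 0"
    using m frob_root_power[of N "plookup r m"] by (auto simp: in_keys_iff power_0_left simp del: frob_root_power)
  ultimately show ?thesis using that by blast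
qed

end

section \<open>Factorizations of the identity through multiplication by an element\<close>

text \<open>
  An ascending chain of subspaces of \<open>k\<^bsup>P\<^esup>\<close>, for \<open>P\<close> finite, written with functions that vanish
  outside \<open>P\<close>. Induction on \<open>P\<close>: if some member \<open>b\<close> of the chain does not vanish at \<open>x\<close>, subtracting a
  multiple of \<open>b\<close> reduces to the subspaces of functions vanishing at \<open>x\<close>.
\<close>
lemma increasing_subspaces_stabilize:
  fixes V :: "nat \<Rightarrow> ('i \<Rightarrow> 'k::field) set"
  assumes "finite P"
    and "\<And>e. (\<lambda>_. 0) \<in> V e"
    and "\<And>e c f g. f \<in> V e \<Longrightarrow> g \<in> V e \<Longrightarrow> (\<lambda>i. f i - c * g i) \<in> V e"
    and "\<And>e. V e \<subseteq> V (Suc e)"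
    and "\<And>e f i. f \<in> V e \<Longrightarrow> i \<notin> P \<Longrightarrow> f i = 0"
  shows "\<exists>e0. \<forall>e. V e \<subseteq> V e0"
  using assms
proof (induction P arbitrary: V rule: finite_induct)
  case empty
  have "V e \<subseteq> V 0" for e
  proof
    fix f assume "f \<in> V e"
    then have "f = (\<lambda>_. 0)" using empty.prems(4) by blast
    then show "f \<in> V 0" using empty.prems(1) by simp
  qed
  then show ?case by blast
next
  case (insert x P)
  note zero = insert.prems(1) and comb = insert.prems(2) and supp = insert.prems(4)
  have mono: "V d \<subseteq> V e" if "d \<le> e" for d e
    using insert.prems(3) that by (rule lift_Suc_mono_le)
  show ?case
  proof (cases "\<exists>e. \<exists>f\<in>V e. f x \<noteq> 0")
    case False
    then have "\<And>e f i. f \<in> V e \<Longrightarrow> i \<notin> P \<Longrightarrow> f i = 0" using supp by (metis insert_iff)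
    with insert.IH[of V] insert.prems(1-3) show ?thesis by blast
  next
    case True
    then obtain d b where b: "b \<in> V d" "b x \<noteq> 0" by blast
    define U where "U e = {f \<in> V (d + e). f x = 0}" for e
    have "\<exists>e0. \<forall>e. U e \<subseteq> U e0"
    proof (rule insert.IH)
      show "(\<lambda>_. 0) \<in> U e" for e using zero by (simp add: U_def)
      show "(\<lambda>i. f i - c * g i) \<in> U e" if "f \<in> U e" "g \<in> U e" for e c f g
        using that comb by (simp add: U_def)
      show "U e \<subseteq> U (Suc e)" for e using insert.prems(3)[of "d + e"] by (auto simp: U_def)
      show "f i = 0" if "f \<in> U e" "i \<notin> P" for e f i
        using that supp by (cases "i = x") (auto simp: U_def)
    qed
    then obtain e0 where e0: "\<And>e. U e \<subseteq> U e0" by blast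
    have "f \<in> V (d + e0)" if "f \<in> V e" for f e
    proof -
      define c where "c = f x / b x"
      have "(\<lambda>i. f i - c * b i) \<in> V (d + e)"
        using that b mono[of e "d + e"] mono[of d "d + e"] by (intro comb) auto
      then have "(\<lambda>i. f i - c * b i) \<in> U e" using b by (simp add: U_def c_def)
      then have "(\<lambda>i. f i - c * b i) \<in> U e0" using e0 by blast
      then have "(\<lambda>i. f i - c * b i) \<in> V (d + e0)" by (simp add: U_def)
      moreover have "b \<in> V (d + e0)" using b mono[of d "d + e0"] by auto
      ultimately have "(\<lambda>i. (f i - c * b i) - (- c) * b i) \<in> V (d + e0)" by (rule comb)
      then show ?thesis by simp
    qed
    then show ?thesis by blast
  qed
qed

text \<open>
  Finite sums of composites \<open>u \<circ> v\<close>: the maps that factor through a finite power of the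
  middle module when the members of \<open>A\<close> and \<open>B\<close> are module maps.
\<close>
inductive_set comp_sums :: "('b \<Rightarrow> 'c) set \<Rightarrow> ('a \<Rightarrow> 'b) set \<Rightarrow> ('a \<Rightarrow> 'c::comm_monoid_add) set"
  for A B where
  zero: "(\<lambda>_. 0) \<in> comp_sums A B"
| step: "h \<in> comp_sums A B \<Longrightarrow> u \<in> A \<Longrightarrow> v \<in> B \<Longrightarrow> (\<lambda>x. h x + u (v x)) \<in> comp_sums A B"

lemma comp_sums_add:
  assumes "h \<in> comp_sums A B" "h' \<in> comp_sums A B"
  shows "(\<lambda>x. h x + h' x) \<in> comp_sums A B"
  using assms(2)
proof (induction rule: comp_sums.induct)
  case (step h' u v)
  from comp_sums.step[OF step.IH step.hyps(2,3)] show ?case by (simp add: add.assoc)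
qed (use assms(1) in simp)

lemma comp_sums_sum:
  assumes "\<And>i. i \<in> J \<Longrightarrow> h i \<in> comp_sums A B"
  shows "(\<lambda>x. \<Sum>i\<in>J. h i x) \<in> comp_sums A B"
  using assms
proof (induction J rule: infinite_finite_induct)
  case (insert i J)
  then show ?case using comp_sums_add[of "h i" A B "\<lambda>x. \<Sum>i\<in>J. h i x"] by simp
qed (simp_all add: comp_sums.zero)

text \<open>
  Transfers a factorization along pre- and postcomposition. The equation is required on \<open>D\<close> only,
  since the maps of interest are constrained on \<open>R\<close> alone.
\<close>
lemma comp_sums_sandwich:
  assumes h: "h \<in> comp_sums A B"
    and f: "f 0 = 0" "\<And>x y. f (x + y) = f x + f y"
    and ex: "\<And>u v. u \<in> A \<Longrightarrow> v \<in> B \<Longrightarrow> \<exists>u'\<in>A'. \<exists>v'\<in>B'. \<forall>x\<in>D. u' (v' x) = f (u (v (g x)))"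
  shows "\<exists>h'\<in>comp_sums A' B'. \<forall>x\<in>D. h' x = f (h (g x))"
  using h
proof (induction rule: comp_sums.induct)
  case zero
  show ?case by (rule bexI[OF _ comp_sums.zero]) (simp add: f)
next
  case (step h u v)
  then obtain h' where h': "h' \<in> comp_sums A' B'" "\<forall>x\<in>D. h' x = f (h (g x))" by blast
  obtain u' v' where uv: "u' \<in> A'" "v' \<in> B'" "\<forall>x\<in>D. u' (v' x) = f (u (v (g x)))"
    using ex step.hyps by blast
  show ?case
    by (rule bexI[OF _ comp_sums.step[OF h'(1) uv(1,2)]]) (use h' uv in \<open>simp add: f\<close>)
qed

text \<open>Finite sums of products \<open>s m\<close>. The scalars \<open>S\<close> are a mere set here: \<open>k\<close> or \<open>R\<close>.\<close>
inductive_set scalar_span :: "'k::field mpoly set \<Rightarrow> 'k mpoly set \<Rightarrow> 'k mpoly set" for S M where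
  zero: "0 \<in> scalar_span S M"
| step: "s \<in> S \<Longrightarrow> m \<in> M \<Longrightarrow> x \<in> scalar_span S M \<Longrightarrow> s * m + x \<in> scalar_span S M"

lemma scalar_span_add:
  assumes "x \<in> scalar_span S M" "y \<in> scalar_span S M"
  shows "x + y \<in> scalar_span S M"
  using assms(1)
proof (induction rule: scalar_span.induct)
  case (step s m x)
  from scalar_span.step[OF step.hyps(1,2) step.IH] show ?case by (simp only: add.assoc)
qed (use assms(2) in simp)

lemma scalar_span_base:
  assumes "s \<in> S" "m \<in> M"
  shows "s * m \<in> scalar_span S M"
  using scalar_span.step[OF assms scalar_span.zero] by (simp only: add_0_right)

lemma scalar_span_mult:
  assumes "x \<in> scalar_span S M" "\<And>s. s \<in> S \<Longrightarrow> r * s \<in> S"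
  shows "r * x \<in> scalar_span S M"
  using assms(1)
proof (induction rule: scalar_span.induct)
  case (step s m x)
  from scalar_span.step[OF assms(2)[OF step.hyps(1)] step.hyps(2) step.IH]
  show ?case by (simp only: distrib_left mult.assoc)
qed (simp add: scalar_span.zero)

lemma generated_algebra_monomials:
  assumes "x \<in> generated_algebra F" "finite F"
  shows "x \<in> scalar_span (range (mterm 0)) (range (\<lambda>a::_ \<Rightarrow> nat. \<Prod>f\<in>F. f ^ a f))"
    (is "_ \<in> scalar_span ?S ?M")
  using assms(1)
proof (induction rule: generated_algebra.induct)
  case (const c)
  have "1 \<in> ?M" by (rule image_eqI[of _ _ "\<lambda>_. 0"]) auto
  then show ?case using scalar_span_base[of "mterm 0 c" ?S 1 ?M] by simp
next
  case (mult g r)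
  have M: "g * m \<in> ?M" if m: "m \<in> ?M" for m
  proof -
    obtain a where "m = (\<Prod>f\<in>F. f ^ a f)" using m by blast
    moreover have "(\<Prod>f\<in>F. f ^ (a(g := Suc (a g))) f) = g * (\<Prod>f\<in>F. f ^ a f)"
    proof -
      have "(\<Prod>f\<in>F. f ^ (a(g := Suc (a g))) f) = g ^ Suc (a g) * (\<Prod>f\<in>F - {g}. f ^ (a(g := Suc (a g))) f)"
        using prod.remove[OF assms(2) mult.hyps(1), of "\<lambda>f. f ^ (a(g := Suc (a g))) f"] by simp
      also have "(\<Prod>f\<in>F - {g}. f ^ (a(g := Suc (a g))) f) = (\<Prod>f\<in>F - {g}. f ^ a f)"
        by (rule prod.cong) auto
      finally show ?thesis
        using prod.remove[OF assms(2) mult.hyps(1), of "\<lambda>f. f ^ a f"] by (simp only: power_Suc mult.assoc)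
    qed
    ultimately show ?thesis
      by (intro image_eqI[of _ _ "a(g := Suc (a g))"]) (simp_all only: UNIV_I)
  qed
  from mult.IH show ?case
  proof (induction rule: scalar_span.induct)
    case (step s m x)
    have "s * (g * m) + g * x \<in> scalar_span ?S ?M"
      by (rule scalar_span.step) (use step M in auto)
    then show ?case by (simp add: algebra_simps)
  qed (simp add: scalar_span.zero)
qed (rule scalar_span_add)

locale frobenius_retract = graded_retract n w R \<Phi> + perfect_char p "TYPE('k)"
  for n w and R :: "'k::field mpoly set" and \<Phi> p
begin

text \<open>
  Regarding \<open>D\<close> as an \<open>R\<close>-module via \<open>r \<mapsto> r\<^bsup>p^a\<^esup>\<close> and \<open>E\<close> via \<open>r \<mapsto> r\<^bsup>p^b\<^esup>\<close>, these are the \<open>R\<close>-linear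
  maps \<open>D \<rightarrow> E\<close>. For \<open>a = b\<close> they are linear over the subring of \<open>p\<^sup>a\<close>-th powers; \<open>a = 0\<close> and \<open>b = 0\<close> give
  maps that behave like a power and like a root of the Frobenius map.
\<close>
definition semilinear ::
    "'k mpoly set \<Rightarrow> 'k mpoly set \<Rightarrow> nat \<Rightarrow> nat \<Rightarrow> ('k mpoly \<Rightarrow> 'k mpoly) \<Rightarrow> bool" where
  "semilinear D E a b f \<longleftrightarrow> (\<forall>x\<in>D. f x \<in> E) \<and> (\<forall>x\<in>D. \<forall>y\<in>D. f (x + y) = f x + f y) \<and>
     (\<forall>r\<in>R. \<forall>x\<in>D. f (r ^ (p ^ a) * x) = r ^ (p ^ b) * f x)"

lemma semilinearD:
  assumes "semilinear D E a b f"
  shows "x \<in> D \<Longrightarrow> f x \<in> E" "x \<in> D \<Longrightarrow> y \<in> D \<Longrightarrow> f (x + y) = f x + f y"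
    "r \<in> R \<Longrightarrow> x \<in> D \<Longrightarrow> f (r ^ (p ^ a) * x) = r ^ (p ^ b) * f x"
  using assms by (auto simp: semilinear_def)

lemma semilinear_comp:
  assumes "semilinear D E a b f" "semilinear E G b c g"
  shows "semilinear D G a c (\<lambda>x. g (f x))"
  using assms by (simp add: semilinear_def)

lemma semilinear_shift:
  assumes "semilinear D E a b f"
  shows "semilinear D E (k + a) (k + b) f"
  unfolding semilinear_def
proof (intro conjI ballI)
  fix r x assume "r \<in> R" "x \<in> D"
  then show "f (r ^ (p ^ (k + a)) * x) = r ^ (p ^ (k + b)) * f x"
    using semilinearD(3)[OF assms R_power, of r x "p ^ k"]
    by (simp add: power_add power_mult)
qed (use semilinearD[OF assms] in auto)

lemma semilinear_mono:
  "semilinear D E a b f \<Longrightarrow> D' \<subseteq> D \<Longrightarrow> E \<subseteq> E' \<Longrightarrow> semilinear D' E' a b f"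
  unfolding semilinear_def by blast

lemma frob_semilinear: "semilinear R R 0 e (\<lambda>x. x ^ (p ^ e))"
  by (auto simp: semilinear_def R_power frob_add_mpoly power_mult_distrib)

lemma frob_coeff_semilinear: "semilinear R (vars_lt n) e 0 (frob_coeff e a)"
  by (auto simp: semilinear_def frob_coeff_add frob_coeff_mult R_vars frob_coeff_vars)

lemma Phi_frob_semilinear: "semilinear UNIV R 0 e (\<lambda>s. \<Phi> (f * s ^ (p ^ e)))"
proof -
  have "\<Phi> (f * (r * s) ^ (p ^ e)) = r ^ (p ^ e) * \<Phi> (f * s ^ (p ^ e))" if "r \<in> R" for r s
    using Phi_mult[OF R_power[OF that, of "p ^ e"], of "f * s ^ (p ^ e)"]
    by (simp add: power_mult_distrib mult_ac)
  then show ?thesis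
    by (auto simp: semilinear_def Phi_in frob_add_mpoly distrib_left Phi_add)
qed

text \<open>
  The coordinate of \<open>r\<close> that is a nonzero constant yields a root linear map on polynomials
  sending \<open>r\<close> to \<open>1\<close>, and \<open>\<Phi>\<close> brings it back to \<open>R\<close>. For \<open>r = 1\<close> this is a Frobenius splitting
  of \<open>R\<close>; in general it says that \<open>R\<close> is strongly F-regular.
\<close>
lemma frobenius_splitting:
  assumes "c \<noteq> 0" "frob_coeff e m r = mterm 0 c"
  obtains \<psi> where "semilinear R R e 0 \<psi>" "\<And>x. x \<in> R \<Longrightarrow> \<psi> (r * x ^ (p ^ e)) = x"
proof
  let ?\<psi> = "\<lambda>x. \<Phi> (mterm 0 (1 / c) * frob_coeff e m x)"
  have "?\<psi> (s ^ (p ^ e) * x) = s * ?\<psi> x" if "s \<in> R" for s x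
    using Phi_mult[OF that, of "mterm 0 (1 / c) * frob_coeff e m x"]
    by (simp only: frob_coeff_mult mult.left_commute[of "mterm 0 (1 / c)" s])
  then show "semilinear R R e 0 ?\<psi>"
    by (auto simp: semilinear_def Phi_in Phi_add frob_coeff_add distrib_left)
  show "?\<psi> (r * x ^ (p ^ e)) = x" if "x \<in> R" for x
    using frob_coeff_mult[of e m x r] assms Phi_id[OF that]
    by (simp add: mult.commute[of r] mult.left_commute[of "mterm 0 (1 / c)" x] mult_single)
qed

text \<open>
  Under the identification of \<open>R\<^bsup>1/q\<^esup>\<close> with \<open>R\<close>, these are the \<open>R\<close>-linear maps from \<open>R\<^bsup>1/q\<^esup>\<close> to the
  polynomials and back, and \<open>factoring e\<close> consists of the \<open>R\<close>-linear endomorphisms of the polynomial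
  ring that factor through a finite power of \<open>R\<^bsup>1/q\<^esup>\<close>.
\<close>
abbreviation "root_maps e \<equiv> Collect (semilinear R (vars_lt n) e 0)"
abbreviation "power_maps e \<equiv> Collect (semilinear UNIV R 0 e)"
abbreviation "factoring e \<equiv> comp_sums (root_maps e) (power_maps e)"

lemma factoring_linear:
  assumes "g \<in> factoring e"
  shows "g (x + y) = g x + g y" "r \<in> R \<Longrightarrow> g (r * x) = r * g x"
proof -
  show "g (x + y) = g x + g y"
    using assms
  proof (induction rule: comp_sums.induct)
    case (step h u v)
    then show ?case by (simp add: semilinear_def)
  qed simp
  show "g (r * x) = r * g x" if "r \<in> R"
    using assms
  proof (induction rule: comp_sums.induct)
    case (step h u v)
    then show ?case using that by (simp add: semilinear_def distrib_left)
  qed simp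
qed

text \<open>Insert \<open>y = \<psi> (y\<^sup>p)\<close>, for a Frobenius splitting \<open>\<psi>\<close>, between the two maps of a composite.\<close>
lemma factoring_Suc: "factoring e \<subseteq> factoring (Suc e)"
proof
  fix g assume g: "g \<in> factoring e"
  have "mono_mod (p ^ 1) 0 = 0" "mono_div (p ^ 1) 0 = 0" by (auto intro: poly_mapping_eqI)
  then have "frob_coeff 1 0 1 = mterm 0 1"
    using frob_coeff_single[of 1 0 0 1] by simp
  then obtain \<psi> where \<psi>: "semilinear R R 1 0 \<psi>" "\<And>x. x \<in> R \<Longrightarrow> \<psi> (x ^ (p ^ 1)) = x"
    using frobenius_splitting[of 1 1 0 1] by auto
  have "\<exists>h\<in>factoring (Suc e). \<forall>x\<in>UNIV. h x = id (g (id x))"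
  proof (rule comp_sums_sandwich[OF g])
    fix u v assume "u \<in> root_maps e" "v \<in> power_maps e"
    then have u: "semilinear R (vars_lt n) e 0 u" and v: "semilinear UNIV R 0 e v" by auto
    have "semilinear R (vars_lt n) (e + 1) 0 (\<lambda>x. u (\<psi> x))"
      using semilinear_comp[OF semilinear_shift[OF \<psi>(1), of e]] u by simp
    moreover have "semilinear UNIV R 0 (e + 1) (\<lambda>x. v x ^ (p ^ 1))"
      using semilinear_comp[OF v] semilinear_shift[OF frob_semilinear[of 1], of e] by simp
    moreover have "u (\<psi> (v x ^ (p ^ 1))) = id (u (v (id x)))" for x
      using \<psi>(2)[OF semilinearD(1)[OF v, of x]] by simp
    ultimately show "\<exists>u'\<in>root_maps (Suc e). \<exists>v'\<in>power_maps (Suc e). \<forall>x\<in>UNIV. u' (v' x) = id (u (v (id x)))"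
      by auto
  qed auto
  then obtain h where h: "h \<in> factoring (Suc e)" "\<forall>x\<in>UNIV. h x = id (g (id x))" by blast
  then have "h = g" by (simp add: fun_eq_iff)
  with h(1) show "g \<in> factoring (Suc e)" by simp
qed

lemma factoring_combine:
  assumes "f \<in> factoring e" "g \<in> factoring e"
  shows "(\<lambda>x. f x - mterm 0 c * g x) \<in> factoring e"
proof -
  have "\<exists>h\<in>factoring e. \<forall>x\<in>UNIV. h x = mterm 0 (- c) * g (id x)"
  proof (rule comp_sums_sandwich[OF assms(2)])
    fix u v assume u: "u \<in> root_maps e" and v: "v \<in> power_maps e"
    have "(\<lambda>x. mterm 0 (- c) * u x) \<in> root_maps e"
      using u by (auto simp: semilinear_def algebra_simps intro!: vars_lt_mult vars_lt_single)
    then show "\<exists>u'\<in>root_maps e. \<exists>v'\<in>power_maps e. \<forall>x\<in>UNIV. u' (v' x) = mterm 0 (- c) * u (v (id x))"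
      using v by fastforce
  qed (auto simp: distrib_left)
  then obtain h where h: "h \<in> factoring e" "\<forall>x\<in>UNIV. h x = mterm 0 (- c) * g (id x)" by blast
  then show ?thesis using comp_sums_add[OF assms(1) h(1)] by (simp add: single_uminus)
qed

lemma semilinear_agree_on_span:
  assumes "x \<in> scalar_span R M"
    and "g \<in> factoring e" "h \<in> factoring e'" "\<And>m. m \<in> M \<Longrightarrow> g m = h m"
  shows "g x = h x"
  using assms(1)
proof (induction rule: scalar_span.induct)
  case zero
  show ?case using factoring_linear(2)[OF assms(2) R_0, of 0] factoring_linear(2)[OF assms(3) R_0, of 0] by simp
next
  case (step s m x)
  then show ?case using assms(4) by (simp add: factoring_linear[OF assms(2)] factoring_linear[OF assms(3)])
qed

abbreviation "monomial_polys B \<equiv> (\<lambda>m. mterm m 1) ` monomials_deg_le n w B"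

lemma low_degree_in_span:
  assumes "f \<in> vars_lt n" "deg_le w B f"
  shows "f \<in> scalar_span R (monomial_polys B)"
proof (induction f rule: poly_mapping_term_induct)
  case (single m c)
  show ?case
  proof (cases "c = 0")
    case False
    then have "m \<in> monomials_deg_le n w B"
      using single assms unfolding monomials_deg_le_def vars_lt_iff deg_le_def by auto
    then have "mterm 0 c * mterm m 1 \<in> scalar_span R (monomial_polys B)"
      by (intro scalar_span_base R_const) blast
    then show ?thesis by (simp add: mult_single)
  qed (simp add: scalar_span.zero)
qed (rule scalar_span_add)

text \<open>
  Let \<open>F\<close> generate \<open>R\<close>. Dividing the exponents of a monomial in \<open>F\<close> by \<open>q = p\<^sup>e\<close> with remainder shows
  that \<open>R\<close> is generated over its \<open>q\<close>-th powers by elements of degree at most \<open>q B\<close>, where \<open>B\<close> is the sum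
  of the degrees of the generators; taking coordinates divides degrees by \<open>q\<close>. The
  point is that \<open>B\<close> does not depend on \<open>e\<close>.
\<close>
lemma root_maps_range:
  obtains B where "\<And>e a x. x \<in> R \<Longrightarrow> frob_coeff e a x \<in> scalar_span R (monomial_polys B)"
proof -
  obtain F where F: "finite F" "F \<subseteq> R" "R \<subseteq> generated_algebra F"
    using finitely_generated by blast
  obtain d where d: "\<And>f :: 'k mpoly. deg_le w (d f) f" 
    using choice[of "\<lambda>(f :: 'k mpoly) d. deg_le w d f"] deg_le_exists by blast
  define B where "B = (\<Sum>f\<in>F. d f)"
  have "frob_coeff e a x \<in> scalar_span R (monomial_polys B)" if "x \<in> R" for e a x
  proof -
    let ?q = "p ^ e"
    have "x \<in> scalar_span (range (mterm 0)) (range (\<lambda>a. \<Prod>f\<in>F. f ^ a f))"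
      using generated_algebra_monomials[OF _ F(1)] F(3) that by blast
    then show ?thesis
    proof (induction rule: scalar_span.induct)
      case zero
      show ?case by (simp add: frob_coeff_0 scalar_span.zero)
    next
      case (step s m x)
      then obtain c k where s: "s = mterm 0 c" and m: "m = (\<Prod>f\<in>F. f ^ k f)" by blast
      define r where "r = mterm 0 (frob_root e c) * (\<Prod>f\<in>F. f ^ (k f div ?q))"
      define y where "y = (\<Prod>f\<in>F. f ^ (k f mod ?q))"
      have "mono_scale ?q 0 = 0" by (rule poly_mapping_eqI) simp
      then have "s = mterm 0 (frob_root e c) ^ ?q"
        unfolding s term_power by simp
      moreover have "m = (\<Prod>f\<in>F. f ^ (k f div ?q)) ^ ?q * y"
        unfolding m y_def prod_power_distrib prod.distrib[symmetric]
        by (intro prod.cong refl) (simp only: power_add[symmetric] power_mult[symmetric] div_mult_mod_eq)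
      ultimately have sm: "s * m = r ^ ?q * y"
        by (simp add: r_def power_mult_distrib mult.assoc)
      have r: "r \<in> R" unfolding r_def using F by (intro R_mult R_const R_prod R_power) auto
      have y: "y \<in> R" unfolding y_def using F by (intro R_prod R_power) auto
      have "deg_le w (\<Sum>f\<in>F. k f mod ?q * d f) y"
        unfolding y_def by (intro deg_le_prod deg_le_power d)
      moreover have "(\<Sum>f\<in>F. k f mod ?q * d f) \<le> ?q * B"
        unfolding B_def sum_distrib_left by (intro sum_mono mult_right_mono) auto
      ultimately have "deg_le w B (frob_coeff e a y)"
        by (intro frob_coeff_deg_le) (rule deg_le_mono)
      then have "frob_coeff e a y \<in> scalar_span R (monomial_polys B)"
        using frob_coeff_vars[OF R_vars[OF y]] by (intro low_degree_in_span)
      then have "r * frob_coeff e a y \<in> scalar_span R (monomial_polys B)"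
        using r R_mult by (intro scalar_span_mult)
      then show ?case using step.IH by (simp add: sm frob_coeff_add frob_coeff_mult scalar_span_add)
    qed
  qed
  then show ?thesis by (rule that)
qed

text \<open>
  A map is recorded by the coefficients of its values on the finitely many monomials of degree at
  most \<open>B\<close>. With values of degree at most \<open>C\<close> these records have bounded support, and they form
  subspaces that increase with \<open>e\<close>.
\<close>
lemma factoring_stabilizes:
  obtains e0 where "\<And>e g. g \<in> factoring e \<Longrightarrow>
      (\<And>m. m \<in> monomials_deg_le n w B \<Longrightarrow> g (mterm m 1) \<in> vars_lt n \<and> deg_le w C (g (mterm m 1))) \<Longrightarrow>
      \<exists>h\<in>factoring e0. \<forall>m \<in> monomials_deg_le n w B. h (mterm m 1) = g (mterm m 1)"
proof -
  define code where "code g = (\<lambda>(m, m'). if m \<in> monomials_deg_le n w B then plookup (g (mterm m 1)) m' else 0)"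
    for g :: "'k mpoly \<Rightarrow> 'k mpoly"
  define bounded where "bounded g \<longleftrightarrow> (\<forall>m \<in> monomials_deg_le n w B.
      g (mterm m 1) \<in> vars_lt n \<and> deg_le w C (g (mterm m 1)))" for g :: "'k mpoly \<Rightarrow> 'k mpoly"
  define V where "V e = {code g | g. g \<in> factoring e \<and> bounded g}" for e
  have "\<exists>e0. \<forall>e. V e \<subseteq> V e0"
  proof (rule increasing_subspaces_stabilize)
    show "finite (monomials_deg_le n w B \<times> monomials_deg_le n w C)"
      by (intro finite_cartesian_product finite_monomials_deg_le w_pos)
    show "(\<lambda>_. 0) \<in> V e" for e
    proof -
      have "code (\<lambda>_. 0) = (\<lambda>_. 0)" "bounded (\<lambda>_. 0)"
        by (auto simp: code_def bounded_def vars_lt_zero)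
      then show ?thesis unfolding V_def using comp_sums.zero by force
    qed
    show "(\<lambda>i. f i - c * g i) \<in> V e" if fg: "f \<in> V e" "g \<in> V e" for e c f g
    proof -
      obtain f' g' where f': "f = code f'" "f' \<in> factoring e" "bounded f'"
        and g': "g = code g'" "g' \<in> factoring e" "bounded g'" using fg by (auto simp: V_def)
      let ?h = "\<lambda>x. f' x - mterm 0 c * g' x"
      have "(\<lambda>i. f i - c * g i) = code ?h"
        using lookup_term_mult[of "0 :: nat \<Rightarrow>\<^sub>0 nat" c]
        by (auto simp: fun_eq_iff f' g' code_def lookup_minus)
      moreover have "bounded ?h"
        unfolding bounded_def
      proof (intro ballI conjI)
        fix m assume m: "m \<in> monomials_deg_le n w B"
        then have *: "f' (mterm m 1) \<in> vars_lt n" "g' (mterm m 1) \<in> vars_lt n"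
          "deg_le w C (f' (mterm m 1))" "deg_le w C (g' (mterm m 1))"
          using f' g' by (auto simp: bounded_def)
        then show "f' (mterm m 1) - mterm 0 c * g' (mterm m 1) \<in> vars_lt n"
          by (intro vars_lt_diff vars_lt_mult vars_lt_single) auto
        have "deg_le w (0 + C) (mterm 0 (- c) * g' (mterm m 1))"
          using * by (intro deg_le_mult deg_le_single) auto
        then show "deg_le w C (f' (mterm m 1) - mterm 0 c * g' (mterm m 1))"
          using deg_le_add[OF *(3)] by (force simp: single_uminus)
      qed
      ultimately show ?thesis unfolding V_def using factoring_combine[OF f'(2) g'(2)] by blast
    qed
    show "V e \<subseteq> V (Suc e)" for e using factoring_Suc[of e] by (auto simp: V_def)
    show "f i = 0" if "f \<in> V e" "i \<notin> monomials_deg_le n w B \<times> monomials_deg_le n w C" for e f i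
    proof -
      obtain g where g: "f = code g" "bounded g" using \<open>f \<in> V e\<close> by (auto simp: V_def)
      obtain m m' where i: "i = (m, m')" by (cases i)
      have "plookup (g (mterm m 1)) m' = 0" if "m \<in> monomials_deg_le n w B"
      proof -
        have "m' \<notin> monomials_deg_le n w C"
          using that \<open>i \<notin> _\<close> i by auto
        moreover have "g (mterm m 1) \<in> vars_lt n" "deg_le w C (g (mterm m 1))"
          using g that by (auto simp: bounded_def)
        ultimately have "m' \<notin> pkeys (g (mterm m 1))"
          unfolding monomials_deg_le_def vars_lt_iff deg_le_def by blast
        then show ?thesis by (simp add: in_keys_iff)
      qed
      then show ?thesis by (simp add: g i code_def)
    qed
  qed
  then obtain e0 where e0: "\<And>e. V e \<subseteq> V e0" by blast
  show ?thesis
  proof (rule that)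
    fix e g assume g: "g \<in> factoring e"
      "\<And>m. m \<in> monomials_deg_le n w B \<Longrightarrow> g (mterm m 1) \<in> vars_lt n \<and> deg_le w C (g (mterm m 1))"
    then have "code g \<in> V e" unfolding V_def bounded_def by blast
    then have "code g \<in> V e0" using e0 by blast
    then obtain h where h: "code h = code g" "h \<in> factoring e0" unfolding V_def by (auto; metis)
    have "h (mterm m 1) = g (mterm m 1)" if "m \<in> monomials_deg_le n w B" for m
      using fun_cong[OF h(1), of "(m, _)"] that by (intro poly_mapping_eqI) (simp add: code_def)
    then show "\<exists>h\<in>factoring e0. \<forall>m \<in> monomials_deg_le n w B. h (mterm m 1) = g (mterm m 1)"
      using h by blast
  qed
qed

text \<open>
  Level \<open>e = e\<^sub>0 + e\<^sub>1\<close> combines the level \<open>e\<^sub>0\<close> at which the spaces of factoring maps become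
  constant with a level \<open>e\<^sub>1\<close> at which \<open>r\<close> is sent to \<open>1\<close> by a root linear \<open>\<psi>\<close>. In
  \<open>id = \<Sum>\<^sub>a\<^sub>b u\<^sub>a (v\<^sub>a u\<^sub>b) v\<^sub>b\<close> each middle map agrees, on the range of \<open>v\<^sub>b\<close>, with a
  sum of composites \<open>v' u'\<close> from level \<open>e\<^sub>0\<close>, and
  \<open>u\<^sub>a v' u' v\<^sub>b = (u\<^sub>a v' \<psi>) \<circ> r \<circ> (u' v\<^sub>b)\<^bsup>p^e\<^sub>1\<^esup>\<close>.
\<close>
theorem identity_factors:
  assumes "r \<in> R" "r \<noteq> 0"
  obtains e h where
    "h \<in> comp_sums (Collect (semilinear R R e e)) {\<lambda>x. r * v x | v. semilinear R R e e v}"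
    "\<And>x. x \<in> R \<Longrightarrow> h x = x"
proof -
  obtain e1 m c where "c \<noteq> 0" "frob_coeff e1 m r = mterm 0 c" using frob_coeff_lead[OF assms(2)] .
  then obtain \<psi> where \<psi>: "semilinear R R e1 0 \<psi>" "\<And>x. x \<in> R \<Longrightarrow> \<psi> (r * x ^ (p ^ e1)) = x"
    using frobenius_splitting by blast
  obtain B where B: "\<And>e a x. x \<in> R \<Longrightarrow> frob_coeff e a x \<in> scalar_span R (monomial_polys B)"
    by (rule root_maps_range) blast
  obtain e0 where e0: "\<And>e g. g \<in> factoring e \<Longrightarrow>
      (\<And>m. m \<in> monomials_deg_le n w B \<Longrightarrow>
         g (mterm m 1) \<in> vars_lt n \<and> deg_le w ((\<Sum>i<n. w i) + B) (g (mterm m 1))) \<Longrightarrow>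
      \<exists>h\<in>factoring e0. \<forall>m \<in> monomials_deg_le n w B. h (mterm m 1) = g (mterm m 1)"
    by (rule factoring_stabilizes) blast
  \<comment> \<open>Any \<open>e \<ge> e\<^sub>0\<close> would do for the expansion of the identity; the excess \<open>e\<^sub>1\<close> makes room for \<open>\<psi>\<close>.\<close>
  define e where "e = e0 + e1"
  let ?box = "frob_box n e"
  let ?A = "Collect (semilinear R R e e)" and ?B = "{\<lambda>x. r * v x | v. semilinear R R e e v}"
  define v where "v = frob_coeff e"
  define u where "u a = (\<lambda>s. \<Phi> (mterm a 1 * s ^ (p ^ e)))" for a
  have v: "semilinear R (vars_lt n) e 0 (v a)" for a
    unfolding v_def by (rule frob_coeff_semilinear)
  have u: "semilinear UNIV R 0 e (u a)" for a
    unfolding u_def by (rule Phi_frob_semilinear)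
  have u_add: "u a (s + t) = u a s + u a t" for a s t
    using semilinearD(2)[OF u] by simp
  have u_0: "u a 0 = 0" for a by (simp add: u_def power_0_left Phi_0)
  have uv: "(\<Sum>a\<in>?box. u a (v a x)) = x" if "x \<in> R" for x
    unfolding u_def v_def Phi_sum[symmetric]
    using frob_expansion[OF R_vars[OF that], of e] Phi_id[OF that] by simp
  have vu: "\<exists>g\<in>factoring e0. \<forall>s \<in> scalar_span R (monomial_polys B). g s = v a (u b s)"
    if ab: "a \<in> ?box" "b \<in> ?box" for a b
  proof -
    let ?g = "\<lambda>s. v a (u b s)"
    have g: "?g \<in> factoring e"
      using comp_sums.step[OF comp_sums.zero, of "v a" "root_maps e" "u b" "power_maps e"] u v by simp
    have "?g (mterm m 1) \<in> vars_lt n \<and> deg_le w ((\<Sum>i<n. w i) + B) (?g (mterm m 1))"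
      if m: "m \<in> monomials_deg_le n w B" for m
    proof
      show "?g (mterm m 1) \<in> vars_lt n"
        using semilinearD(1)[OF v semilinearD(1)[OF u]] by simp
      have "deg_le w (wdeg w b + p ^ e * B) (mterm b 1 * mterm m 1 ^ (p ^ e))"
        using m by (intro deg_le_mult deg_le_power deg_le_single) (auto simp: monomials_deg_le_def)
      then have "deg_le w (p ^ e * ((\<Sum>i<n. w i) + B)) (mterm b 1 * mterm m 1 ^ (p ^ e))"
        by (rule deg_le_mono) (use wdeg_frob_box[OF ab(2), of w] in \<open>simp add: distrib_left\<close>)
      then show "deg_le w ((\<Sum>i<n. w i) + B) (?g (mterm m 1))"
        unfolding v_def u_def by (intro frob_coeff_deg_le Phi_deg_le)
    qed
    then obtain h where h: "h \<in> factoring e0"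
      "\<And>m. m \<in> monomials_deg_le n w B \<Longrightarrow> h (mterm m 1) = ?g (mterm m 1)"
      using e0[OF g] by blast
    have "h s = ?g s" if "s \<in> scalar_span R (monomial_polys B)" for s
      using semilinear_agree_on_span[OF that h(1) g] h(2) by blast
    then show ?thesis using h(1) by blast
  qed
  have "\<exists>h\<in>comp_sums ?A ?B. \<forall>x\<in>R. h x = u a (v a (u b (v b x)))"
    if ab: "a \<in> ?box" "b \<in> ?box" for a b
  proof -
    obtain g where g: "g \<in> factoring e0"
      "\<And>s. s \<in> scalar_span R (monomial_polys B) \<Longrightarrow> g s = v a (u b s)"
      using vu[OF ab] by blast
    have "\<exists>h\<in>comp_sums ?A ?B. \<forall>x\<in>R. h x = u a (g (v b x))"
    proof (rule comp_sums_sandwich[OF g(1) u_0 u_add])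
      fix v' u' assume "v' \<in> root_maps e0" "u' \<in> power_maps e0"
      then have v': "semilinear R (vars_lt n) e0 0 v'" and u': "semilinear UNIV R 0 e0 u'" by auto
      define \<alpha> where "\<alpha> x = u a (v' x)" for x
      define \<beta> where "\<beta> x = u' (v b x)" for x
      have \<alpha>: "semilinear R R e0 e \<alpha>"
        unfolding \<alpha>_def by (rule semilinear_comp[OF v' semilinear_mono[OF u]]) auto
      have \<beta>: "semilinear R R e e0 \<beta>"
        unfolding \<beta>_def by (rule semilinear_comp[OF v semilinear_mono[OF u']]) auto
      have 1: "(\<lambda>x. \<alpha> (\<psi> x)) \<in> ?A"
        using semilinear_comp[OF semilinear_shift[OF \<psi>(1), of e0]] \<alpha> by (simp add: e_def)
      have 3: "semilinear R R e e (\<lambda>x. \<beta> x ^ (p ^ e1))"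
        using semilinear_comp[OF \<beta>] semilinear_shift[OF frob_semilinear[of e1], of e0] by (simp add: e_def)
      have 2: "(\<lambda>x. r * \<beta> x ^ (p ^ e1)) \<in> ?B"
        by (rule CollectI, rule exI[of _ "\<lambda>x. \<beta> x ^ (p ^ e1)"], rule conjI[OF refl 3])
      have "\<alpha> (\<psi> (r * \<beta> x ^ (p ^ e1))) = u a (v' (u' (v b x)))" if "x \<in> R" for x
        using \<psi>(2)[OF semilinearD(1)[OF \<beta> that]] by (simp add: \<alpha>_def \<beta>_def)
      then show "\<exists>f\<in>?A. \<exists>g\<in>?B. \<forall>x\<in>R. f (g x) = u a (v' (u' (v b x)))"
        by (intro bexI[OF bexI[OF ballI 2] 1])
    qed
    moreover have "g (v b x) = v a (u b (v b x))" if "x \<in> R" for x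
      using g(2) B[OF that] unfolding v_def by blast
    ultimately show ?thesis by simp
  qed
  then have "\<forall>a b. \<exists>h. a \<in> ?box \<longrightarrow> b \<in> ?box \<longrightarrow>
      h \<in> comp_sums ?A ?B \<and> (\<forall>x\<in>R. h x = u a (v a (u b (v b x))))"
    by blast
  then obtain h where h: "\<And>a b. a \<in> ?box \<Longrightarrow> b \<in> ?box \<Longrightarrow> h a b \<in> comp_sums ?A ?B"
    "\<And>a b x. a \<in> ?box \<Longrightarrow> b \<in> ?box \<Longrightarrow> x \<in> R \<Longrightarrow> h a b x = u a (v a (u b (v b x)))"
    unfolding choice_iff by blast
  have "(\<lambda>x. \<Sum>b\<in>?box. \<Sum>a\<in>?box. h a b x) \<in> comp_sums ?A ?B"
    using h(1) by (intro comp_sums_sum)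
  moreover have "(\<Sum>b\<in>?box. \<Sum>a\<in>?box. h a b x) = x" if x: "x \<in> R" for x
  proof -
    have "(\<Sum>b\<in>?box. \<Sum>a\<in>?box. h a b x) = (\<Sum>b\<in>?box. \<Sum>a\<in>?box. u a (v a (u b (v b x))))"
      using h(2) x by (intro sum.cong) auto
    also have "\<dots> = (\<Sum>b\<in>?box. u b (v b x))"
      by (intro sum.cong uv semilinearD(1)[OF u]) auto
    finally show ?thesis using uv[OF x] by simp
  qed
  ultimately show ?thesis by (rule that)
qed

end

section \<open>Differential operators\<close>

definition ad :: "'k::field mpoly \<Rightarrow> ('k mpoly \<Rightarrow> 'k mpoly) \<Rightarrow> 'k mpoly \<Rightarrow> 'k mpoly" where
  "ad r \<theta> = (\<lambda>x. r * \<theta> x - \<theta> (r * x))"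

lemma ad_commute: "ad f (ad g \<theta>) = ad g (ad f \<theta>)"
  by (simp add: ad_def fun_eq_iff algebra_simps)

lemma ad_funpow_commute: "(ad f ^^ k) (ad g \<theta>) = ad g ((ad f ^^ k) \<theta>)"
  by (induction k) (simp_all add: ad_commute[of f])

text \<open>
  Left multiplication by \<open>f\<close> and precomposition with multiplication by \<open>f\<close> commute, so
  \<open>(L - R)\<^sup>q = L\<^sup>q - R\<^sup>q\<close> in characteristic \<open>p\<close>. To apply the binomial theorem in a commutative
  ring, powers of an auxiliary variable stand for powers of the precomposition operator, and \<open>ev\<close>
  evaluates them at \<open>\<theta>\<close>.
\<close>
lemma (in perfect_char) ad_frobenius:
  fixes f :: "'k mpoly"
  shows "(ad f ^^ (p ^ e)) \<theta> = ad (f ^ (p ^ e)) \<theta>"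
proof
  fix x
  define ev where "ev x = term_extend (\<lambda>i c. c * \<theta> (f ^ i * x))" for x
  have ev_add: "ev x (P + Q) = ev x P + ev x Q" for x P Q
    unfolding ev_def by (rule term_extend_add) (simp_all add: distrib_right)
  have ev_single: "ev x (mterm i c) = c * \<theta> (f ^ i * x)" for x i c
    unfolding ev_def by (rule term_extend_single) simp
  have ev_diff: "ev x (P - Q) = ev x P - ev x Q" for x P Q
    using ev_add[of x "P - Q" Q] by simp
  have ev_f: "ev x (mterm 0 f * P) = f * ev x P" for x P
    by (induction P rule: poly_mapping_term_induct)
      (simp_all add: mult_single ev_single ev_add distrib_left mult.assoc)
  have ev_var: "ev x (mterm (Suc 0) 1 * P) = ev (f * x) P" for x P
  proof (induction P rule: poly_mapping_term_induct)
    case (single i c)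
    show ?case by (simp add: mult_single ev_single mult_ac)
  qed (simp only: distrib_left ev_add)
  have iter: "(ad f ^^ k) \<theta> x = ev x ((mterm 0 f - mterm (Suc 0) 1) ^ k)" for k x
  proof (induction k arbitrary: x)
    case 0
    show ?case using ev_single[of x 0 1] by simp
  next
    case (Suc k)
    have "(ad f ^^ Suc k) \<theta> x = f * (ad f ^^ k) \<theta> x - (ad f ^^ k) \<theta> (f * x)"
      by (simp add: ad_def)
    with Suc show ?case by (simp add: left_diff_distrib ev_diff ev_f ev_var)
  qed
  have frob: "(y + z) ^ (p ^ e) = y ^ (p ^ e) + z ^ (p ^ e)" for y z :: "nat \<Rightarrow>\<^sub>0 'k mpoly"
    by (rule freshmans_dream'[where n = e]) (use p_prime in \<open>simp_all add: char_poly_mapping p_char\<close>)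
  have pow: "mterm i c ^ k = mterm (k * i) (c ^ k)" for i k and c :: "'k mpoly"
    by (induction k) (simp_all add: mult_single add.commute)
  have "(mterm 0 f - mterm (Suc 0) 1) ^ (p ^ e) = mterm 0 (f ^ (p ^ e)) - mterm (p ^ e) (1 :: 'k mpoly)"
    using frob[of "mterm 0 f - mterm (Suc 0) 1" "mterm (Suc 0) 1"] by (simp add: pow)
  then show "(ad f ^^ (p ^ e)) \<theta> x = ad (f ^ (p ^ e)) \<theta> x"
    by (simp add: iter ev_diff ev_single ad_def)
qed

context graded_retract
begin

definition k_linear :: "('k mpoly \<Rightarrow> 'k mpoly) \<Rightarrow> bool" where
  "k_linear \<theta> \<longleftrightarrow> (\<forall>x\<in>R. \<theta> x \<in> R) \<and> (\<forall>x\<in>R. \<forall>y\<in>R. \<theta> (x + y) = \<theta> x + \<theta> y) \<and>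
     (\<forall>c. \<forall>x\<in>R. \<theta> (mterm 0 c * x) = mterm 0 c * \<theta> x)"

text \<open>
  Differential operators of order at most \<open>m\<close> on \<open>R\<close>, as a property of the values on \<open>R\<close> only. The
  operators in \<open>diff_ops\<close> are the extensional maps with this property (\<open>diff_ops_iff\<close> below).
\<close>
primrec is_diff_op :: "nat \<Rightarrow> ('k mpoly \<Rightarrow> 'k mpoly) \<Rightarrow> bool" where
  "is_diff_op 0 \<theta> \<longleftrightarrow> k_linear \<theta> \<and> (\<forall>r\<in>R. \<forall>x\<in>R. \<theta> (r * x) = r * \<theta> x)"
| "is_diff_op (Suc m) \<theta> \<longleftrightarrow> k_linear \<theta> \<and> (\<forall>r\<in>R. is_diff_op m (ad r \<theta>))"

lemma k_linearD:
  assumes "k_linear \<theta>"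
  shows "x \<in> R \<Longrightarrow> \<theta> x \<in> R" "x \<in> R \<Longrightarrow> y \<in> R \<Longrightarrow> \<theta> (x + y) = \<theta> x + \<theta> y"
    "x \<in> R \<Longrightarrow> \<theta> (mterm 0 c * x) = mterm 0 c * \<theta> x"
  using assms by (auto simp: k_linear_def)

lemma k_linear_diff:
  assumes "k_linear \<theta>" "x \<in> R" "y \<in> R"
  shows "\<theta> (x - y) = \<theta> x - \<theta> y"
  using k_linearD(2)[OF assms(1) R_diff[OF assms(2,3)] assms(3)] by simp

lemma is_diff_op_k_linear: "is_diff_op m \<theta> \<Longrightarrow> k_linear \<theta>"
  by (cases m) auto

lemma k_linear_cong: "(\<And>x. x \<in> R \<Longrightarrow> \<theta> x = \<eta> x) \<Longrightarrow> k_linear \<theta> \<longleftrightarrow> k_linear \<eta>"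
  by (simp add: k_linear_def R_add R_mult R_const)

lemma is_diff_op_cong: "(\<And>x. x \<in> R \<Longrightarrow> \<theta> x = \<eta> x) \<Longrightarrow> is_diff_op m \<theta> \<longleftrightarrow> is_diff_op m \<eta>"
proof (induction m arbitrary: \<theta> \<eta>)
  case 0
  then show ?case using k_linear_cong[of \<theta> \<eta>] by (simp add: R_mult)
next
  case (Suc m)
  have "is_diff_op m (ad r \<theta>) \<longleftrightarrow> is_diff_op m (ad r \<eta>)" if "r \<in> R" for r
    using that by (intro Suc.IH) (simp add: ad_def Suc.prems R_mult)
  then show ?case using k_linear_cong[of \<theta> \<eta>] Suc.prems by simp
qed

lemma is_diff_op_0: "is_diff_op m (\<lambda>_. 0)"
  by (induction m) (auto simp: k_linear_def ad_def R_0)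

lemma is_diff_op_zero: "(\<And>x. x \<in> R \<Longrightarrow> \<theta> x = 0) \<Longrightarrow> is_diff_op m \<theta>"
  using is_diff_op_cong[of \<theta> "\<lambda>_. 0" m] is_diff_op_0[of m] by simp

lemma k_linear_add: "k_linear \<theta> \<Longrightarrow> k_linear \<eta> \<Longrightarrow> k_linear (\<lambda>x. \<theta> x + \<eta> x)"
  by (simp add: k_linear_def R_add distrib_left)

lemma k_linear_comp: "k_linear \<theta> \<Longrightarrow> k_linear \<eta> \<Longrightarrow> k_linear (\<lambda>x. \<theta> (\<eta> x))"
  by (simp add: k_linear_def)

lemma is_diff_op_add:
  "is_diff_op m \<theta> \<Longrightarrow> is_diff_op m \<eta> \<Longrightarrow> is_diff_op m (\<lambda>x. \<theta> x + \<eta> x)"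
proof (induction m arbitrary: \<theta> \<eta>)
  case 0
  then show ?case by (simp add: k_linear_add distrib_left)
next
  case (Suc m)
  have "ad r (\<lambda>x. \<theta> x + \<eta> x) = (\<lambda>x. ad r \<theta> x + ad r \<eta> x)" for r
    by (simp add: ad_def algebra_simps)
  then show ?case using Suc by (simp add: k_linear_add)
qed

lemma is_diff_op_mult: "r \<in> R \<Longrightarrow> is_diff_op 0 (\<lambda>x. r * x)"
  by (simp add: k_linear_def R_mult distrib_left mult.left_commute)

lemma is_diff_op_0_ad: "is_diff_op 0 \<theta> \<Longrightarrow> r \<in> R \<Longrightarrow> x \<in> R \<Longrightarrow> ad r \<theta> x = 0"
  by (simp add: ad_def)

lemma is_diff_op_Suc: "is_diff_op m \<theta> \<Longrightarrow> is_diff_op (Suc m) \<theta>"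
proof (induction m arbitrary: \<theta>)
  case 0
  then show ?case
    using is_diff_op_0_ad[OF 0] is_diff_op_k_linear[OF 0]
    by (auto intro!: is_diff_op_zero simp del: is_diff_op.simps(1))
next
  case (Suc m)
  then show ?case by (metis is_diff_op.simps(2))
qed


lemma is_diff_op_mono:
  assumes "is_diff_op m \<theta>" "m \<le> l"
  shows "is_diff_op l \<theta>"
  using assms(2) by (induction rule: dec_induct) (use assms(1) is_diff_op_Suc in blast)+

text \<open>The commutator with \<open>r\<close> is a derivation with respect to composition.\<close>
lemma is_diff_op_comp:
  "is_diff_op a \<theta> \<Longrightarrow> is_diff_op b \<eta> \<Longrightarrow> is_diff_op (a + b) (\<lambda>x. \<theta> (\<eta> x))"
proof (induction "a + b" arbitrary: a b \<theta> \<eta>)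
  case 0
  then show ?case by (auto simp: k_linear_comp dest: k_linearD(1))
next
  case (Suc k)
  note lin = is_diff_op_k_linear[OF Suc.prems(1)] is_diff_op_k_linear[OF Suc.prems(2)]
  have "is_diff_op k (ad r (\<lambda>x. \<theta> (\<eta> x)))" if r: "r \<in> R" for r
  proof -
    have "is_diff_op k (\<lambda>x. ad r \<theta> (\<eta> x))"
    proof (cases a)
      case 0
      then show ?thesis
        using Suc.prems(1) r k_linearD(1)[OF lin(2)]
        by (intro is_diff_op_zero) (simp add: is_diff_op_0_ad del: is_diff_op.simps)
    next
      case (Suc a')
      then show ?thesis using Suc.hyps(1)[of a' b "ad r \<theta>" \<eta>] Suc.hyps(2) Suc.prems r by simp
    qed
    moreover have "is_diff_op k (\<lambda>x. \<theta> (ad r \<eta> x))"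
    proof (cases b)
      case 0
      have "\<theta> 0 = 0" using k_linear_diff[OF lin(1) R_0 R_0] by simp
      then show ?thesis
        using Suc.prems(2) r 0
        by (intro is_diff_op_zero) (simp add: is_diff_op_0_ad del: is_diff_op.simps)
    next
      case (Suc b')
      then show ?thesis using Suc.hyps(1)[of a b' \<theta> "ad r \<eta>"] Suc.hyps(2) Suc.prems r by simp
    qed
    ultimately have "is_diff_op k (\<lambda>x. ad r \<theta> (\<eta> x) + \<theta> (ad r \<eta> x))" by (rule is_diff_op_add)
    moreover have "ad r (\<lambda>x. \<theta> (\<eta> x)) x = ad r \<theta> (\<eta> x) + \<theta> (ad r \<eta> x)" if "x \<in> R" for x
      using that r k_linearD(1)[OF lin(2)] k_linear_diff[OF lin(1), of "r * \<eta> x" "\<eta> (r * x)"]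
      by (simp add: ad_def R_mult)
    ultimately show ?thesis
      by (subst is_diff_op_cong[where \<eta> = "\<lambda>x. ad r \<theta> (\<eta> x) + \<theta> (ad r \<eta> x)"])
  qed
  then show ?case using k_linear_comp[OF lin] by (simp flip: Suc.hyps(2))
qed

lemma is_diff_op_mult_left: "r \<in> R \<Longrightarrow> is_diff_op m \<theta> \<Longrightarrow> is_diff_op m (\<lambda>x. r * \<theta> x)"
  using is_diff_op_comp[OF is_diff_op_mult] by simp

lemma is_diff_op_mult_right: "r \<in> R \<Longrightarrow> is_diff_op m \<theta> \<Longrightarrow> is_diff_op m (\<lambda>x. \<theta> (r * x))"
  using is_diff_op_comp[OF _ is_diff_op_mult, of m \<theta> r] by simp

lemma k_linear_ad:
  assumes "k_linear \<theta>" "r \<in> R"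
  shows "k_linear (ad r \<theta>)"
proof -
  have "\<theta> (r * (mterm 0 c * x)) = mterm 0 c * \<theta> (r * x)" if "x \<in> R" for c x
    using k_linearD(3)[OF assms(1) R_mult[OF assms(2) that], of c]
    by (simp only: mult.left_commute[of r "mterm 0 c"])
  then show ?thesis
    using assms by (simp add: k_linear_def ad_def R_mult R_diff algebra_simps)
qed

text \<open>
  The order is bounded by the sum of the nilpotency exponents. Taking the commutator with a generator
  lowers one exponent, and the identity \<open>[g r, \<theta>] = g [r, \<theta>] + [g, \<theta>] r\<close> extends the bound on the
  orders of commutators from the generators to all of \<open>R\<close>.
\<close>
lemma is_diff_op_if_ad_nilpotent:
  assumes F: "finite F" "F \<subseteq> R" "R \<subseteq> generated_algebra F"
    and "k_linear \<theta>" "\<And>f x. f \<in> F \<Longrightarrow> x \<in> R \<Longrightarrow> (ad f ^^ k f) \<theta> x = 0" "(\<Sum>f\<in>F. k f) \<le> N"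
  shows "is_diff_op (Suc N) \<theta>"
  using assms(4-6)
proof (induction N arbitrary: \<theta> k rule: less_induct)
  case (less N)
  note lin = less.prems(1)
  have ad_gen: "is_diff_op N (ad g \<theta>)" if g: "g \<in> F" for g
  proof (cases "k g")
    case 0
    then have "\<theta> x = 0" if "x \<in> R" for x using less.prems(2)[OF g that] by simp
    then show ?thesis using g F(2) R_mult by (intro is_diff_op_zero) (auto simp: ad_def)
  next
    case (Suc j)
    have sum: "(\<Sum>f\<in>F. (k(g := j)) f) < (\<Sum>f\<in>F. k f)"
      using F(1) g Suc by (intro sum_strict_mono_ex1) auto
    have "(ad f ^^ (k(g := j)) f) (ad g \<theta>) x = 0" if "f \<in> F" "x \<in> R" for f x
    proof (cases "f = g")
      case True
      then show ?thesis using less.prems(2)[OF g that(2)] Suc by (simp add: funpow_swap1)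
    next
      case False
      have "g * x \<in> R" using g F(2) R_mult that by blast
      then show ?thesis
        using less.prems(2)[OF that] less.prems(2)[OF that(1), of "g * x"] False
        unfolding ad_funpow_commute by (simp add: ad_def[of g])
    qed
    moreover have "(\<Sum>f\<in>F. (k(g := j)) f) \<le> N - 1" "N - 1 < N" using sum less.prems(3) by auto
    moreover have "k_linear (ad g \<theta>)" using g F(2) lin by (intro k_linear_ad) auto
    ultimately have "is_diff_op (Suc (N - 1)) (ad g \<theta>)" by (intro less.IH)
    then show ?thesis using \<open>N - 1 < N\<close> by simp
  qed
  have "r \<in> R \<and> is_diff_op N (ad r \<theta>)" if "r \<in> generated_algebra F" for r
    using that
  proof (induction rule: generated_algebra.induct)
    case (const c)
    show ?case using k_linearD(3)[OF lin] R_const by (auto intro!: is_diff_op_zero simp: ad_def)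
  next
    case (mult g r)
    have "g \<in> R" using mult F(2) by blast
    then have "is_diff_op N (\<lambda>x. g * ad r \<theta> x + ad g \<theta> (r * x))"
      using mult ad_gen by (intro is_diff_op_add is_diff_op_mult_left is_diff_op_mult_right) auto
    moreover have "(\<lambda>x. g * ad r \<theta> x + ad g \<theta> (r * x)) = ad (g * r) \<theta>"
      by (simp add: ad_def algebra_simps)
    ultimately show ?case using \<open>g \<in> R\<close> mult.IH R_mult by simp
  next
    case (add r s)
    then have "is_diff_op N (\<lambda>x. ad r \<theta> x + ad s \<theta> x)" by (intro is_diff_op_add) auto
    moreover have "ad (r + s) \<theta> x = ad r \<theta> x + ad s \<theta> x" if "x \<in> R" for x
      using add that k_linearD(2)[OF lin, of "r * x" "s * x"] R_mult by (simp add: ad_def algebra_simps)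
    ultimately have "is_diff_op N (ad (r + s) \<theta>)"
      by (subst is_diff_op_cong[where \<eta> = "\<lambda>x. ad r \<theta> x + ad s \<theta> x"])
    then show ?case using add R_add by blast
  qed
  then show ?case using lin F(3) by auto
qed

end

context frobenius_retract
begin

text \<open>
  With \<open>q = p\<^sup>e\<close>, the \<open>q\<close>-fold commutator with \<open>f \<in> R\<close> is the commutator with \<open>f\<^sup>q\<close>, which vanishes on
  maps that are linear over \<open>q\<close>-th powers. Linearity over \<open>k\<close> holds because \<open>k\<close> consists of \<open>q\<close>-th powers.
\<close>
lemma semilinear_is_diff_op:
  assumes "semilinear R R e e \<theta>"
  shows "\<exists>m. is_diff_op m \<theta>"
proof -
  obtain F where F: "finite F" "F \<subseteq> R" "R \<subseteq> generated_algebra F" using finitely_generated by blast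
  have "\<theta> (mterm 0 c * x) = mterm 0 c * \<theta> x" if "x \<in> R" for c x
  proof -
    have "mono_scale (p ^ e) 0 = 0" by (rule poly_mapping_eqI) simp
    then have "(mterm 0 c :: 'k mpoly) = mterm 0 (frob_root e c) ^ (p ^ e)" by (simp add: term_power)
    then show ?thesis using semilinearD(3)[OF assms R_const that] by metis
  qed
  then have "k_linear \<theta>" using semilinearD(1,2)[OF assms] by (simp add: k_linear_def)
  moreover have "(ad f ^^ (p ^ e)) \<theta> x = 0" if "f \<in> F" "x \<in> R" for f x
    using semilinearD(3)[OF assms, of f x] that F(2) by (auto simp: ad_frobenius ad_def)
  ultimately show ?thesis
    using is_diff_op_if_ad_nilpotent[OF F, of \<theta> "\<lambda>_. p ^ e"] by blast
qed

end

section \<open>The ring of differential operators is simple\<close>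

lemma poly_algebra_sel [simp]:
  "f \<otimes>\<^bsub>poly_algebra n\<^esub> g = f * g" "f \<oplus>\<^bsub>poly_algebra n\<^esub> g = f + g"
  "\<zero>\<^bsub>poly_algebra n\<^esub> = 0" "\<one>\<^bsub>poly_algebra n\<^esub> = 1"
  "c \<odot>\<^bsub>poly_algebra n\<^esub> f = mterm 0 c * f"
  by (simp_all add: poly_algebra_def)

context graded_retract
begin

abbreviation \<D> :: "('k mpoly \<Rightarrow> 'k mpoly) ring" where
  "\<D> \<equiv> diff_op_ring (ring_of_type_algebra :: 'k ring) (subalg n R)"

lemma subalg_minus: "x \<in> R \<Longrightarrow> y \<in> R \<Longrightarrow> x \<ominus>\<^bsub>subalg n R\<^esub> y = x - y"
proof -
  assume xy: "x \<in> R" "y \<in> R"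
  have "abelian_group (subalg n R)"
    by (rule abelian_groupI) (auto simp: R_add R_0 add_ac intro!: bexI[of _ "- _"] R_uminus)
  then interpret abelian_group "subalg n R" .
  have "\<ominus>\<^bsub>subalg n R\<^esub> y = - y" by (rule minus_equality) (use xy R_uminus in auto)
  then show ?thesis by (simp add: a_minus_def)
qed

lemma diff_ops_iff:
  "\<theta> \<in> diff_ops (ring_of_type_algebra :: 'k ring) (subalg n R) m \<longleftrightarrow> \<theta> \<in> extensional R \<and> is_diff_op m \<theta>"
proof (induction m arbitrary: \<theta>)
  case 0
  have "k_linear \<theta>" if "\<forall>x\<in>R. \<theta> x \<in> R" "\<forall>x\<in>R. \<forall>y\<in>R. \<theta> (x + y) = \<theta> x + \<theta> y"
    "\<forall>r\<in>R. \<forall>x\<in>R. \<theta> (r * x) = r * \<theta> x"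
    using that R_const by (simp add: k_linear_def)
  then show ?case
    by (auto simp: module_Hom_def regular_module_def PiE_iff dest: k_linearD)
next
  case (Suc m)
  have hom: "\<theta> \<in> module_Hom (ring_of_type_algebra :: 'k ring) (subalg n R) (subalg n R) \<longleftrightarrow>
      \<theta> \<in> extensional R \<and> k_linear \<theta>"
    by (auto simp: module_Hom_def PiE_iff k_linear_def ring_of_type_algebra_def)
  have "(\<lambda>x\<in>R. r * \<theta> x \<ominus>\<^bsub>subalg n R\<^esub> \<theta> (r * x)) \<in> diff_ops (ring_of_type_algebra :: 'k ring) (subalg n R) m
      \<longleftrightarrow> is_diff_op m (ad r \<theta>)" if "k_linear \<theta>" "r \<in> R" for r
  proof -
    have eq: "(\<lambda>x\<in>R. r * \<theta> x \<ominus>\<^bsub>subalg n R\<^esub> \<theta> (r * x)) = restrict (ad r \<theta>) R"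
      by (rule restrict_ext)
        (use that in \<open>simp add: subalg_minus R_mult k_linearD(1) ad_def\<close>)
    have "is_diff_op m (restrict (ad r \<theta>) R) \<longleftrightarrow> is_diff_op m (ad r \<theta>)"
      by (rule is_diff_op_cong) simp
    then show ?thesis by (simp only: eq Suc.IH restrict_extensional simp_thms)
  qed
  then show ?case using hom by auto
qed

lemma \<D>_sel:
  "carrier \<D> = {\<theta> \<in> extensional R. \<exists>m. is_diff_op m \<theta>}"
  "\<theta> \<otimes>\<^bsub>\<D>\<^esub> \<eta> = compose R \<theta> \<eta>" "\<theta> \<oplus>\<^bsub>\<D>\<^esub> \<eta> = (\<lambda>x\<in>R. \<theta> x + \<eta> x)"
  "\<zero>\<^bsub>\<D>\<^esub> = (\<lambda>x\<in>R. 0)" "\<one>\<^bsub>\<D>\<^esub> = (\<lambda>x\<in>R. x)"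
  by (auto simp: diff_op_ring_def diff_ops_iff)

lemma \<D>_restrict: "is_diff_op m \<theta> \<Longrightarrow> restrict \<theta> R \<in> carrier \<D>"
  using is_diff_op_cong[of "restrict \<theta> R" \<theta> m] by (auto simp: \<D>_sel)

lemma \<D>_maps: "\<theta> \<in> carrier \<D> \<Longrightarrow> x \<in> R \<Longrightarrow> \<theta> x \<in> R"
  by (auto simp: \<D>_sel dest: is_diff_op_k_linear k_linearD(1))

lemma \<D>_additive: "\<theta> \<in> carrier \<D> \<Longrightarrow> x \<in> R \<Longrightarrow> y \<in> R \<Longrightarrow> \<theta> (x + y) = \<theta> x + \<theta> y"
  by (auto simp: \<D>_sel dest: is_diff_op_k_linear k_linearD(2))

lemma \<D>_add_closed:
  assumes "\<theta> \<in> carrier \<D>" "\<eta> \<in> carrier \<D>"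
  shows "\<theta> \<oplus>\<^bsub>\<D>\<^esub> \<eta> \<in> carrier \<D>"
proof -
  obtain a b where ab: "is_diff_op a \<theta>" "is_diff_op b \<eta>" using assms by (auto simp: \<D>_sel)
  have "is_diff_op (max a b) (\<lambda>x. \<theta> x + \<eta> x)"
    by (rule is_diff_op_add) (rule is_diff_op_mono[OF ab(1)] is_diff_op_mono[OF ab(2)], simp)+
  from \<D>_restrict[OF this] show ?thesis by (simp add: \<D>_sel)
qed

lemma \<D>_mult_closed:
  assumes "\<theta> \<in> carrier \<D>" "\<eta> \<in> carrier \<D>"
  shows "\<theta> \<otimes>\<^bsub>\<D>\<^esub> \<eta> \<in> carrier \<D>"
proof -
  obtain a b where ab: "is_diff_op a \<theta>" "is_diff_op b \<eta>" using assms by (auto simp: \<D>_sel)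
  from \<D>_restrict[OF is_diff_op_comp[OF ab]] show ?thesis by (simp add: \<D>_sel compose_def)
qed

lemma \<D>_mult_op: "r \<in> R \<Longrightarrow> (\<lambda>x\<in>R. r * x) \<in> carrier \<D>"
  by (rule \<D>_restrict[OF is_diff_op_mult])

lemma \<D>_one: "\<one>\<^bsub>\<D>\<^esub> \<in> carrier \<D>"
  using \<D>_mult_op[OF R_1] by (simp add: \<D>_sel)

lemma \<D>_zero: "\<zero>\<^bsub>\<D>\<^esub> \<in> carrier \<D>"
  using \<D>_mult_op[OF R_0] by (simp add: \<D>_sel)

lemma ring_\<D>: "ring \<D>"
proof (rule ringI)
  have ext: "\<theta> \<in> extensional R" if "\<theta> \<in> carrier \<D>" for \<theta> using that by (simp add: \<D>_sel)
  note maps = \<D>_maps and additive = \<D>_additive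
  show "abelian_group \<D>"
  proof (rule abelian_groupI)
    fix \<theta> \<eta> \<zeta>
    assume t: "\<theta> \<in> carrier \<D>"
    show "\<exists>\<eta>\<in>carrier \<D>. \<eta> \<oplus>\<^bsub>\<D>\<^esub> \<theta> = \<zero>\<^bsub>\<D>\<^esub>"
    proof
      show "(\<lambda>x\<in>R. (- 1) * x) \<otimes>\<^bsub>\<D>\<^esub> \<theta> \<in> carrier \<D>"
        by (intro \<D>_mult_closed \<D>_mult_op R_uminus R_1 t)
      show "((\<lambda>x\<in>R. (- 1) * x) \<otimes>\<^bsub>\<D>\<^esub> \<theta>) \<oplus>\<^bsub>\<D>\<^esub> \<theta> = \<zero>\<^bsub>\<D>\<^esub>"
        using maps[OF t] by (intro extensionalityI[where A = R]) (auto simp: \<D>_sel(2-5) compose_def)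
    qed
    show "\<zero>\<^bsub>\<D>\<^esub> \<oplus>\<^bsub>\<D>\<^esub> \<theta> = \<theta>"
      using ext[OF t] by (intro extensionalityI[where A = R]) (auto simp: \<D>_sel(2-5))
    assume "\<eta> \<in> carrier \<D>"
    show "\<theta> \<oplus>\<^bsub>\<D>\<^esub> \<eta> = \<eta> \<oplus>\<^bsub>\<D>\<^esub> \<theta>"
      by (simp add: \<D>_sel(2-5) add.commute)
    assume "\<zeta> \<in> carrier \<D>"
    show "\<theta> \<oplus>\<^bsub>\<D>\<^esub> \<eta> \<oplus>\<^bsub>\<D>\<^esub> \<zeta> = \<theta> \<oplus>\<^bsub>\<D>\<^esub> (\<eta> \<oplus>\<^bsub>\<D>\<^esub> \<zeta>)"
      by (intro extensionalityI[where A = R]) (auto simp: \<D>_sel(2-5) add.assoc)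
  qed (intro \<D>_add_closed \<D>_zero; assumption)+
  show "Group.monoid \<D>"
  proof (rule monoidI)
    fix \<theta> \<eta> \<zeta>
    assume t: "\<theta> \<in> carrier \<D>"
    show "\<one>\<^bsub>\<D>\<^esub> \<otimes>\<^bsub>\<D>\<^esub> \<theta> = \<theta>" "\<theta> \<otimes>\<^bsub>\<D>\<^esub> \<one>\<^bsub>\<D>\<^esub> = \<theta>"
      using ext[OF t] maps[OF t] by (auto intro!: extensionalityI[where A = R] simp: \<D>_sel(2-5) compose_def)
    assume "\<eta> \<in> carrier \<D>" and z: "\<zeta> \<in> carrier \<D>"
    show "\<theta> \<otimes>\<^bsub>\<D>\<^esub> \<eta> \<otimes>\<^bsub>\<D>\<^esub> \<zeta> = \<theta> \<otimes>\<^bsub>\<D>\<^esub> (\<eta> \<otimes>\<^bsub>\<D>\<^esub> \<zeta>)"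
      using maps[OF z] by (intro extensionalityI[where A = R]) (auto simp: \<D>_sel(2-5) compose_def)
  qed (intro \<D>_mult_closed \<D>_one; assumption)+
  fix \<theta> \<eta> \<zeta>
  assume t: "\<theta> \<in> carrier \<D>" and h: "\<eta> \<in> carrier \<D>" and z: "\<zeta> \<in> carrier \<D>"
  show "(\<theta> \<oplus>\<^bsub>\<D>\<^esub> \<eta>) \<otimes>\<^bsub>\<D>\<^esub> \<zeta> = \<theta> \<otimes>\<^bsub>\<D>\<^esub> \<zeta> \<oplus>\<^bsub>\<D>\<^esub> \<eta> \<otimes>\<^bsub>\<D>\<^esub> \<zeta>"
    using maps[OF z] by (intro extensionalityI[where A = R]) (auto simp: \<D>_sel(2-5) compose_def)
  show "\<zeta> \<otimes>\<^bsub>\<D>\<^esub> (\<theta> \<oplus>\<^bsub>\<D>\<^esub> \<eta>) = \<zeta> \<otimes>\<^bsub>\<D>\<^esub> \<theta> \<oplus>\<^bsub>\<D>\<^esub> \<zeta> \<otimes>\<^bsub>\<D>\<^esub> \<eta>"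
    using maps[OF t] maps[OF h] by (intro extensionalityI[where A = R]) (auto simp: \<D>_sel(2-5) compose_def additive[OF z])
qed

text \<open>
  Induction on the order of an element of \<open>J\<close>. If all its commutators with elements of \<open>R\<close> vanish,
  it is \<open>R\<close>-linear and hence a multiplication.
\<close>
lemma ideal_contains_multiplication:
  assumes J: "ideal J \<D>" and "\<theta> \<in> J" "is_diff_op m \<theta>" "\<theta> \<noteq> \<zero>\<^bsub>\<D>\<^esub>"
  shows "\<exists>r\<in>R. r \<noteq> 0 \<and> (\<lambda>x\<in>R. r * x) \<in> J"
  using assms(2-4)
proof (induction m arbitrary: \<theta>)
  case 0
  have ext: "\<theta> \<in> extensional R" using ideal.Icarr[OF J 0(1)] by (simp add: \<D>_sel)
  have lin: "\<theta> x = \<theta> 1 * x" if "x \<in> R" for x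
  proof -
    have "\<theta> (x * 1) = x * \<theta> 1" using 0(2) that R_1 by (simp del: mult_1_right)
    then show ?thesis by (simp add: mult.commute)
  qed
  then have "\<theta> = (\<lambda>x\<in>R. \<theta> 1 * x)" using ext by (intro extensionalityI[where A = R]) auto
  moreover have "\<theta> 1 \<in> R" using 0(2) R_1 by (auto simp: k_linear_def)
  moreover have "\<theta> 1 \<noteq> 0" using 0(3) calculation(1) by (auto simp: \<D>_sel)
  ultimately show ?case using 0(1) by metis
next
  case (Suc m)
  have car: "\<theta> \<in> carrier \<D>" using ideal.Icarr[OF J Suc.prems(1)] .
  have lin: "k_linear \<theta>" using Suc.prems(2) by simp
  have ad_J: "restrict (ad r \<theta>) R \<in> J" if r: "r \<in> R" for r
  proof -
    have "((\<lambda>x\<in>R. r * x) \<otimes>\<^bsub>\<D>\<^esub> \<theta>) \<oplus>\<^bsub>\<D>\<^esub> (\<theta> \<otimes>\<^bsub>\<D>\<^esub> (\<lambda>x\<in>R. (- r) * x)) \<in> J"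
      using ideal.I_l_closed[OF J Suc.prems(1) \<D>_mult_op[OF r]]
        ideal.I_r_closed[OF J Suc.prems(1) \<D>_mult_op[OF R_uminus[OF r]]]
        additive_subgroup.a_closed[OF ideal.axioms(1)[OF J]] by blast
    moreover have "\<theta> (- (r * x)) = - \<theta> (r * x)" if "x \<in> R" for x
      using k_linear_diff[OF lin R_0 R_mult[OF r that]] k_linear_diff[OF lin R_0 R_0] by simp
    then have "((\<lambda>x\<in>R. r * x) \<otimes>\<^bsub>\<D>\<^esub> \<theta>) \<oplus>\<^bsub>\<D>\<^esub> (\<theta> \<otimes>\<^bsub>\<D>\<^esub> (\<lambda>x\<in>R. (- r) * x)) = restrict (ad r \<theta>) R"
      using \<D>_maps[OF car] by (intro extensionalityI[where A = R]) (auto simp: \<D>_sel(2-5) compose_def ad_def)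
    ultimately show ?thesis by simp
  qed
  show ?case
  proof (cases "\<exists>r\<in>R. restrict (ad r \<theta>) R \<noteq> \<zero>\<^bsub>\<D>\<^esub>")
    case True
    then obtain r where r: "r \<in> R" "restrict (ad r \<theta>) R \<noteq> \<zero>\<^bsub>\<D>\<^esub>" by blast
    have "is_diff_op m (restrict (ad r \<theta>) R)"
      using Suc.prems(2) r(1) is_diff_op_cong[of "restrict (ad r \<theta>) R" "ad r \<theta>" m] by simp
    then show ?thesis using Suc.IH[OF ad_J[OF r(1)]] r(2) by blast
  next
    case False
    have "\<theta> (r * x) = r * \<theta> x" if "r \<in> R" "x \<in> R" for r x
    proof -
      have "restrict (ad r \<theta>) R x = \<zero>\<^bsub>\<D>\<^esub> x" using False that by simp
      then show ?thesis using that by (simp add: \<D>_sel ad_def)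
    qed
    then have "is_diff_op m \<theta>" using lin is_diff_op_mono[of 0 \<theta> m] by simp
    then show ?thesis using Suc.IH Suc.prems by blast
  qed
qed

end

theorem (in frobenius_retract) simple_ring_\<D>: "simple_ring \<D>"
  unfolding simple_ring_def
proof (intro conjI allI impI)
  show "ring \<D>" by (rule ring_\<D>)
  interpret ring \<D> by (rule ring_\<D>)
  have "\<one>\<^bsub>\<D>\<^esub> 1 \<noteq> \<zero>\<^bsub>\<D>\<^esub> 1" using R_1 by (simp add: \<D>_sel)
  then show "carrier \<D> \<noteq> {\<zero>\<^bsub>\<D>\<^esub>}" using one_closed by (metis singletonD)
  fix J assume J: "ideal J \<D>"
  then interpret J: ideal J \<D> .
  show "J = {\<zero>\<^bsub>\<D>\<^esub>} \<or> J = carrier \<D>"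
  proof (cases "J = {\<zero>\<^bsub>\<D>\<^esub>}")
    case False
    then obtain \<theta> where \<theta>: "\<theta> \<in> J" "\<theta> \<noteq> \<zero>\<^bsub>\<D>\<^esub>" using J.zero_closed by blast
    then obtain m where "is_diff_op m \<theta>" using J.Icarr[OF \<theta>(1)] by (auto simp: \<D>_sel)
    then obtain r where r: "r \<in> R" "r \<noteq> 0" "(\<lambda>x\<in>R. r * x) \<in> J"
      using ideal_contains_multiplication[OF J \<theta>(1) _ \<theta>(2)] by blast
    obtain e h where h:
      "h \<in> comp_sums (Collect (semilinear R R e e)) {\<lambda>x. r * v x | v. semilinear R R e e v}"
      "\<And>x. x \<in> R \<Longrightarrow> h x = x"
      by (rule identity_factors[OF r(1,2)]) blast
    have op: "restrict u R \<in> carrier \<D>" if "semilinear R R e e u" for u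
      using semilinear_is_diff_op[OF that] \<D>_restrict by blast
    have "restrict h R \<in> J"
      using h(1)
    proof (induction rule: comp_sums.induct)
      case zero
      show ?case using J.zero_closed by (simp add: \<D>_sel restrict_def)
    next
      case (step h u v')
      then obtain v where u: "semilinear R R e e u" and v: "semilinear R R e e v" "v' = (\<lambda>x. r * v x)"
        by blast
      have "restrict h R \<oplus>\<^bsub>\<D>\<^esub> (restrict u R \<otimes>\<^bsub>\<D>\<^esub> ((\<lambda>x\<in>R. r * x) \<otimes>\<^bsub>\<D>\<^esub> restrict v R)) \<in> J"
        using step.IH r(3) op[OF u] op[OF v(1)] by (intro J.a_closed J.I_l_closed J.I_r_closed)
      also have "restrict h R \<oplus>\<^bsub>\<D>\<^esub> (restrict u R \<otimes>\<^bsub>\<D>\<^esub> ((\<lambda>x\<in>R. r * x) \<otimes>\<^bsub>\<D>\<^esub> restrict v R)) =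
          (\<lambda>x\<in>R. h x + u (v' x))"
        using semilinearD(1)[OF v(1)] r(1) R_mult
        by (intro extensionalityI[where A = R]) (auto simp: \<D>_sel(2-5) compose_def v(2))
      finally show ?case .
    qed
    moreover have "restrict h R = \<one>\<^bsub>\<D>\<^esub>"
      using h(2) by (intro extensionalityI[where A = R]) (auto simp: \<D>_sel(2-5))
    ultimately have "\<one>\<^bsub>\<D>\<^esub> \<in> J" by simp
    then show ?thesis using J.one_imp_carrier by simp
  qed simp
qed

lemma graded_retract_if_graded_split:
  fixes R :: "'k::field mpoly set"
  assumes w: "\<And>i. i < n \<Longrightarrow> w i > 0"
    and R: "graded_subalgebra n w R" and split: "graded_split n w R"
  obtains \<Phi> where "graded_retract n w R \<Phi>"
proof -
  have sr: "subring R (poly_algebra n)"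
    and sm: "submodule R (ring_of_type_algebra :: 'k ring) (poly_algebra n)"
    and hom: "\<And>f d. f \<in> R \<Longrightarrow> hom_component w d f \<in> R"
    using R by (auto simp: graded_subalgebra_def)
  obtain \<phi> where \<phi>: "\<phi> \<in> module_Hom (subalg n R) (regular_module (poly_algebra n)) (regular_module (subalg n R))"
    "\<And>d. \<phi> ` poly_piece n w d \<subseteq> R \<inter> poly_piece n w d" "\<And>r. r \<in> R \<Longrightarrow> \<phi> r = r"
    using split by (auto simp: graded_split_def)
  have \<phi>_in: "\<phi> f \<in> R" if "f \<in> vars_lt n" for f
    using \<phi>(1) that by (auto simp: module_Hom_def regular_module_def)
  have \<phi>_add: "\<phi> (f + g) = \<phi> f + \<phi> g" if "f \<in> vars_lt n" "g \<in> vars_lt n" for f g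
    using \<phi>(1) that by (auto simp: module_Hom_def regular_module_def)
  have \<phi>_mult: "\<phi> (r * f) = r * \<phi> f" if "r \<in> R" "f \<in> vars_lt n" for r f
    using \<phi>(1) that by (auto simp: module_Hom_def regular_module_def)
  have R_vars: "r \<in> vars_lt n" if "r \<in> R" for r
    using subringE(1)[OF sr] that by blast
  have one: "1 \<in> R" using subringE(3)[OF sr] by simp
  have "graded_retract n w R (\<lambda>f. \<phi> (drop_vars n f))"
  proof
    show "w i > 0" if "i < n" for i using w that .
    show "r \<in> vars_lt n" if "r \<in> R" for r using R_vars that .
    show "mterm 0 c \<in> R" for c
      using submodule.smult_closed[OF sm, of c 1] one by (simp add: ring_of_type_algebra_def)
    show "r + s \<in> R" "r * s \<in> R" if "r \<in> R" "s \<in> R" for r s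
      using subringE(6,7)[OF sr that] by simp_all
    show "hom_component w d r \<in> R" if "r \<in> R" for r d using hom that .
    show "\<phi> (drop_vars n f) \<in> R" for f by (intro \<phi>_in drop_vars_in)
    show "\<phi> (drop_vars n (f + g)) = \<phi> (drop_vars n f) + \<phi> (drop_vars n g)" for f g
      by (simp add: drop_vars_add \<phi>_add drop_vars_in)
    show "\<phi> (drop_vars n (r * f)) = r * \<phi> (drop_vars n f)" if "r \<in> R" for r f
      using that by (simp add: drop_vars_mult R_vars \<phi>_mult drop_vars_in)
    show "\<phi> (drop_vars n r) = r" if "r \<in> R" for r
      using that by (simp add: drop_vars_id R_vars \<phi>(3))
    show "homogeneous w d (\<phi> (drop_vars n f))" if "homogeneous w d f" for d f
    proof -
      have "drop_vars n f \<in> poly_piece n w d"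
        using that drop_vars_in[of n f]
        by (auto simp: poly_piece_def homogeneous_def drop_vars_def keys_restrict_keys)
      then show ?thesis using \<phi>(2)[of d] by (auto simp: poly_piece_def homogeneous_def)
    qed
  qed
  then show ?thesis by (rule that)
qed

theorem theorem1p3:
  fixes n :: nat and w :: "nat \<Rightarrow> nat" and R :: "'k::field mpoly set"
  assumes "perfect_field TYPE('k)" and "CHAR('k) > 0"
    and "\<And>i. i < n \<Longrightarrow> w i > 0"
    and "graded_subalgebra n w R"
    and "graded_split n w R"
  shows "simple_ring (diff_op_ring (ring_of_type_algebra :: 'k ring) (subalg n R))"
proof -
  obtain \<Phi> where "graded_retract n w R \<Phi>"
    using graded_retract_if_graded_split[OF assms(3-5)] .
  then interpret graded_retract n w R \<Phi> .
  interpret frobenius_retract n w R \<Phi> "CHAR('k)"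
    by unfold_locales (use assms(1,2) perfect_field_root prime_CHAR_semidom in auto)
  show ?thesis by (rule simple_ring_\<D>)
qed

end
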